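(* Let $X=X^+\oplus\widetilde X$ be as in the context. Suppose that there is a family of functionals $J_\lambda\in C^1(X,\mathbb{R})$ of the form $$J_\lambda(u)=\tfrac12\|u^+\|^2-I_\lambda(u)\quad\text{for }u=u^++\widetilde u\in X^+\oplus\widetilde X,$$ where $J_\lambda$ and $I_\lambda$ satisfy (A1)–(A4), (B1)–(B3) and (C2) for every $\lambda\in I\subset\mathbb{R}$, let $\mathcal{N}_\lambda=\{u\in X\setminus\widetilde X:J_\lambda'(u)|_{\mathbb{R}u\oplus\widetilde X}=0\}$, and suppose that $J_\lambda$ is coercive on $\mathcal{N}_\lambda$. Suppose that there is $L>0$ such that $$0<J_{\lambda_1}(u)-J_{\lambda_2}(u)\le L(\lambda_1-\lambda_2)\|u\|^2\quad\text{for }u\in X\setminus\widetilde X\text{ and }\lambda_1>\lambda_2,\ \lambda_1,\lambda_2\in I.$$ Let $c_\lambda:=\inf_{\mathcal{N}_\lambda}J_\lambda$. Then the map $I\ni\lambda\mapsto c_\lambda\in(0,+\infty)$ is non-decreasing and continuous. Moreover, if $c_\lambda$ is attained for every $\lambda\in I$, then the map $I\ni\lambda\mapsto c_\lambda\in(0,+\infty)$ is strictly increasing.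
   Context: $X$ is a reflexive Banach space with norm $\|\cdot\|$ and topological direct sum decomposition $X=X^+\oplus\widetilde X$, where $X^+$ is a Hilbert space; write $u=u^++\widetilde u$ with $u^+\in X^+$, $\widetilde u\in\widetilde X$; $\langle u,u\rangle=\|u\|^2$ for $u\in X^+$ and $\|u\|^2=\|u^+\|^2+\|\widetilde u\|^2$. $u_n\xrightarrow{\mathcal{T}}u$ means $u_n^+\to u^+$ in norm and $\widetilde u_n\rightharpoonup\widetilde u$ weakly. Coercive on $\mathcal{N}_\lambda$ means $J_\lambda(u)\to\infty$ as $u\in\mathcal{N}_\lambda$, $\|u\|\to\infty$. Conditions, for each $\lambda\in I$: (A1) $I_\lambda\in C^1(X,\mathbb{R})$ and $I_\lambda(u)\ge I_\lambda(0)=0$ for all $u\in X$. (A2) If $u_n\xrightarrow{\mathcal{T}}u$ then $\liminf I_\lambda(u_n)\ge I_\lambda(u)$. (A3) If $u_n\xrightarrow{\mathcal{T}}u$ and $I_\lambda(u_n)\to I_\lambda(u)$ then $u_n\to u$. (A4) There is $r>0$ with $\inf_{u\in X^+,\|u\|=r}J_\lambda(u)>0$. (B1) $\|u^+\|+I_\lambda(u)\to\infty$ as $\|u\|\to\infty$. (B2) $I_\lambda(t_nu_n)/t_n^2\to\infty$ if $t_n\to\infty$ and $u_n^+\to u^+$ for some $u^+\ne0$. (B3) $\frac{t^2-1}{2}I_\lambda'(u)(u)+tI_\lambda'(u)(v)+I_\lambda(u)-I_\lambda(tu+v)<0$ for every $u\in\mathcal{N}_\lambda$, $t\ge0$, $v\in\widetilde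 X$ with $u\ne tu+v$. (C2) $I_\lambda(t_nu_n)/t_n^2\to\infty$ if $t_n\to\infty$ and $(I_\lambda(tu_n^+))_n$ is bounded away from $0$ for any $t>1$. *)

theory Defs
  imports "HOL-Analysis.Analysis"
begin

text \<open>Reflexivity: the canonical embedding of the space into its bidual is onto.\<close>

definition reflexive_space :: "'a::real_normed_vector itself \<Rightarrow> bool" where
  "reflexive_space _ \<longleftrightarrow>
     (\<forall>\<Psi> :: ('a \<Rightarrow>\<^sub>L real) \<Rightarrow>\<^sub>L real. \<exists>x::'a. \<forall>\<phi>. blinfun_apply \<Psi> \<phi> = blinfun_apply \<phi> x)"

definition weak_limit :: "(nat \<Rightarrow> 'a::real_normed_vector) \<Rightarrow> 'a \<Rightarrow> bool" where
  "weak_limit u l \<longleftrightarrow>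
     (\<forall>\<phi> :: 'a \<Rightarrow>\<^sub>L real. (\<lambda>n. blinfun_apply \<phi> (u n)) \<longlonglongrightarrow> blinfun_apply \<phi> l)"

text \<open>Positive definiteness is contained in the last conjunct, since the form induces the norm.\<close>

definition hilbert_subspace :: "'a::real_normed_vector set \<Rightarrow> bool" where
  "hilbert_subspace S \<longleftrightarrow> subspace S \<and> complete S \<and>
     (\<exists>ip :: 'a \<Rightarrow> 'a \<Rightarrow> real.
        (\<forall>x\<in>S. \<forall>y\<in>S. ip x y = ip y x) \<and>
        (\<forall>x\<in>S. \<forall>y\<in>S. \<forall>z\<in>S. ip (x + y) z = ip x z + ip y z) \<and>
        (\<forall>c. \<forall>x\<in>S. \<forall>y\<in>S. ip (c *\<^sub>R x) y = c * ip x y) \<and>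
        (\<forall>x\<in>S. ip x x = (norm x)\<^sup>2))"

text \<open>The component of \<open>u\<close> in \<open>Y\<close> along \<open>Z\<close>; meaningful when the space is the direct sum of
  \<open>Y\<close> and \<open>Z\<close>. Below, the first subspace argument \<open>Xp\<close> is always \<open>X\<^sup>+\<close> and the second
  one \<open>Xt\<close> is its complement, so \<open>u\<^sup>+\<close> is \<open>component Xp Xt u\<close> and the remaining part of \<open>u\<close>
  is \<open>component Xt Xp u\<close>.\<close>

definition component :: "'a::real_normed_vector set \<Rightarrow> 'a set \<Rightarrow> 'a \<Rightarrow> 'a" where
  "component Y Z u = (THE y. y \<in> Y \<and> u - y \<in> Z)"

definition topological_direct_sum :: "'a::real_normed_vector set \<Rightarrow> 'a set \<Rightarrow> bool" where
  "topological_direct_sum Y Z \<longleftrightarrow> subspace Y \<and> subspace Z \<and>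
     (\<forall>u. \<exists>!y. y \<in> Y \<and> u - y \<in> Z) \<and>
     continuous_on UNIV (component Y Z) \<and> continuous_on UNIV (component Z Y)"

text \<open>Weak convergence of the \<open>Xt\<close>-components is tested with functionals on the whole space;
  composing with the continuous projection, these restrict onto all functionals on \<open>Xt\<close>.\<close>

definition T_limit ::
    "'a::real_normed_vector set \<Rightarrow> 'a set \<Rightarrow> (nat \<Rightarrow> 'a) \<Rightarrow> 'a \<Rightarrow> bool" where
  "T_limit Xp Xt u l \<longleftrightarrow>
     (\<lambda>n. component Xp Xt (u n)) \<longlonglongrightarrow> component Xp Xt l \<and>
     weak_limit (\<lambda>n. component Xt Xp (u n)) (component Xt Xp l)"

text \<open>Frechet differentiable on the whole space, with derivative continuous into the dual space.\<close>

definition C1_functional :: "('a::real_normed_vector \<Rightarrow> real) \<Rightarrow> bool" where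
  "C1_functional f \<longleftrightarrow>
     (\<exists>D :: 'a \<Rightarrow> ('a \<Rightarrow>\<^sub>L real).
        (\<forall>u. (f has_derivative blinfun_apply (D u)) (at u)) \<and> continuous_on UNIV D)"

definition nehari_pankov_set :: "'a::real_normed_vector set \<Rightarrow> ('a \<Rightarrow> real) \<Rightarrow> 'a set" where
  "nehari_pankov_set Xt J =
     {u. u \<notin> Xt \<and> (\<forall>s. \<forall>v\<in>Xt. frechet_derivative J (at u) (s *\<^sub>R u + v) = 0)}"

text \<open>The infimum is taken in the extended reals, so that it is \<open>\<infinity>\<close> when the constraint set is
  empty, and \<open>-\<infinity>\<close> when the functional is unbounded below.\<close>

definition ground_level :: "'a::real_normed_vector set \<Rightarrow> ('a \<Rightarrow> real) \<Rightarrow> ereal" where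
  "ground_level Xt J = (INF u\<in>nehari_pankov_set Xt J. ereal (J u))"

definition ground_level_attained ::
    "'a::real_normed_vector set \<Rightarrow> ('a \<Rightarrow> real) \<Rightarrow> bool" where
  "ground_level_attained Xt J \<longleftrightarrow>
     (\<exists>u\<in>nehari_pankov_set Xt J. ereal (J u) = ground_level Xt J)"

definition coercive_on :: "'a::real_normed_vector set \<Rightarrow> ('a \<Rightarrow> real) \<Rightarrow> bool" where
  "coercive_on S f \<longleftrightarrow> filterlim f at_top (inf at_infinity (principal S))"

definition cond_A1 :: "('a::real_normed_vector \<Rightarrow> real) \<Rightarrow> bool" where
  "cond_A1 I \<longleftrightarrow> C1_functional I \<and> I 0 = 0 \<and> (\<forall>u. I u \<ge> I 0)"

definition cond_A2 ::
    "'a::real_normed_vector set \<Rightarrow> 'a set \<Rightarrow> ('a \<Rightarrow> real) \<Rightarrow> bool" where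
  "cond_A2 Xp Xt I \<longleftrightarrow>
     (\<forall>u l. T_limit Xp Xt u l \<longrightarrow> liminf (\<lambda>n. ereal (I (u n))) \<ge> ereal (I l))"

definition cond_A3 ::
    "'a::real_normed_vector set \<Rightarrow> 'a set \<Rightarrow> ('a \<Rightarrow> real) \<Rightarrow> bool" where
  "cond_A3 Xp Xt I \<longleftrightarrow>
     (\<forall>u l. T_limit Xp Xt u l \<and> (\<lambda>n. I (u n)) \<longlonglongrightarrow> I l \<longrightarrow> u \<longlonglongrightarrow> l)"

definition cond_A4 :: "'a::real_normed_vector set \<Rightarrow> ('a \<Rightarrow> real) \<Rightarrow> bool" where
  "cond_A4 Xp J \<longleftrightarrow> (\<exists>r>0. (INF u\<in>{u \<in> Xp. norm u = r}. ereal (J u)) > 0)"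

definition cond_B1 ::
    "'a::real_normed_vector set \<Rightarrow> 'a set \<Rightarrow> ('a \<Rightarrow> real) \<Rightarrow> bool" where
  "cond_B1 Xp Xt I \<longleftrightarrow>
     filterlim (\<lambda>u. norm (component Xp Xt u) + I u) at_top at_infinity"

definition cond_B2 ::
    "'a::real_normed_vector set \<Rightarrow> 'a set \<Rightarrow> ('a \<Rightarrow> real) \<Rightarrow> bool" where
  "cond_B2 Xp Xt I \<longleftrightarrow>
     (\<forall>(t :: nat \<Rightarrow> real) (u :: nat \<Rightarrow> 'a).
        filterlim t at_top sequentially \<and>
        (\<exists>p\<in>Xp. p \<noteq> 0 \<and> (\<lambda>n. component Xp Xt (u n)) \<longlonglongrightarrow> p) \<longrightarrow>
        filterlim (\<lambda>n. I (t n *\<^sub>R u n) / (t n)\<^sup>2) at_top sequentially)"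

definition cond_B3 ::
    "'a::real_normed_vector set \<Rightarrow> ('a \<Rightarrow> real) \<Rightarrow> ('a \<Rightarrow> real) \<Rightarrow> bool" where
  "cond_B3 Xt J I \<longleftrightarrow>
     (\<forall>u\<in>nehari_pankov_set Xt J. \<forall>t\<ge>0. \<forall>v\<in>Xt. u \<noteq> t *\<^sub>R u + v \<longrightarrow>
        (t\<^sup>2 - 1) / 2 * frechet_derivative I (at u) u
          + t * frechet_derivative I (at u) v + I u - I (t *\<^sub>R u + v) < 0)"

definition cond_C2 ::
    "'a::real_normed_vector set \<Rightarrow> 'a set \<Rightarrow> ('a \<Rightarrow> real) \<Rightarrow> bool" where
  "cond_C2 Xp Xt I \<longleftrightarrow>
     (\<forall>(t :: nat \<Rightarrow> real) (u :: nat \<Rightarrow> 'a).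
        filterlim t at_top sequentially \<and>
        (\<forall>s>1. \<exists>\<delta>>0. \<forall>n. \<bar>I (s *\<^sub>R component Xp Xt (u n))\<bar> \<ge> \<delta>) \<longrightarrow>
        filterlim (\<lambda>n. I (t n *\<^sub>R u n) / (t n)\<^sup>2) at_top sequentially)"

end

theory Submission
  imports Defs "HOL-Library.Diagonal_Subsequence"
begin

text \<open>
For \<open>u\<close> outside \<open>Xt\<close> let \<open>halfspace Xt u\<close> be the set of all \<open>t *\<^sub>R u + v\<close> with \<open>t \<ge> 0\<close> and \<open>v\<close> in
\<open>Xt\<close>. The Nehari--Pankov set of each functional \<open>J\<close> of the family is described by maxima over
half-spaces: by (B3) each of its points maximises \<open>J\<close> on its own half-space
(\<open>nehari_maximises\<close>), and conversely every half-space carries a maximiser, which belongs to the set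
(\<open>nehari_projection\<close>). The ground level is therefore the infimum over all half-spaces of the maximum
of \<open>J\<close>. Positivity follows from (A4), since every half-space meets the small sphere of \<open>Xp\<close>, and
monotonicity in the parameter is inherited from that of \<open>J\<close>; the inequality is strict at a half-space
where the infimum is attained.

For continuity, the maximum on a given half-space changes by at most \<open>L * (\<mu> - \<nu>) * (norm w)\<^sup>2\<close>,
where \<open>w\<close> is the maximiser for the larger parameter, so it remains to bound these maximisers. Both
bounds come from \<open>superlevel_bounded\<close>: the part of the half-spaces where \<open>J \<ge> 0\<close> is bounded, uniformly over a set
of directions along which \<open>I\<close> stays away from zero on distant parts of the rays. To the right of a
parameter one half-space suffices. To the left the directions vary, but they come from points at which \<open>J\<close> is at
most \<open>c \<mu> + 1\<close>; since these points maximise \<open>J\<close> on their half-spaces, \<open>J\<close> is bounded above along the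
corresponding rays, which is incompatible with a small \<open>I\<close> at a large distance because of the
quadratic term.

The existence of maximisers is the direct method and requires that bounded sequences in a reflexive
space have weakly convergent subsequences. This is derived here from the Hahn--Banach theorem, which
is applied both to the space and to its dual.
\<close>

section \<open>The Hahn--Banach theorem\<close>

text \<open>Homogeneity is imposed only as an inequality and only for positive factors; equality and
\<open>p 0 = 0\<close> follow, and the weaker form is what infima of families satisfy most readily.\<close>

definition sublinear :: "('a::real_vector \<Rightarrow> real) \<Rightarrow> bool" where
  "sublinear p \<longleftrightarrow> (\<forall>x y. p (x + y) \<le> p x + p y) \<and> (\<forall>c>0. \<forall>x. p (c *\<^sub>R x) \<le> c * p x)"

lemma sublinearI:
  assumes "\<And>x y. p (x + y) \<le> p x + p y" and "\<And>c x. c > 0 \<Longrightarrow> p (c *\<^sub>R x) \<le> c * p x"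
  shows "sublinear p"
  using assms by (simp add: sublinear_def)

lemma sublinear_add: "sublinear p \<Longrightarrow> p (x + y) \<le> p x + p y"
  by (simp add: sublinear_def)

lemma sublinear_scale:
  assumes "sublinear p" "c > 0"
  shows "p (c *\<^sub>R x) = c * p x"
proof (rule antisym)
  show "p (c *\<^sub>R x) \<le> c * p x" using assms by (simp add: sublinear_def)
  have "p ((1/c) *\<^sub>R (c *\<^sub>R x)) \<le> (1/c) * p (c *\<^sub>R x)"
    using assms unfolding sublinear_def by (meson divide_pos_pos zero_less_one)
  then show "c * p x \<le> p (c *\<^sub>R x)" using assms(2) by (simp add: field_simps)
qed

lemma sublinear_zero: "sublinear p \<Longrightarrow> p 0 = 0"
  using sublinear_scale[of p 2 0] by simp

lemma sublinear_ge: "sublinear p \<Longrightarrow> - p (- x) \<le> p x"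
  using sublinear_add[of p x "- x"] sublinear_zero[of p] by simp

text \<open>Zorn's lemma applies because all sublinear \<open>q \<le> p\<close> share the pointwise lower bound
\<open>- p (- x)\<close>, so a nonempty chain has a finite pointwise infimum; for subadditivity of that infimum two
members of the chain are compared and the smaller one is used for both summands.\<close>

lemma minimal_sublinear_exists:
  assumes p: "sublinear p"
  shows "\<exists>q. sublinear q \<and> q \<le> p \<and> (\<forall>q'. sublinear q' \<and> q' \<le> q \<longrightarrow> q' = q)"
proof -
  define M where "M = {q. sublinear q \<and> q \<le> p}"
  have "\<exists>m\<in>M. \<forall>a\<in>M. a \<le> m \<longrightarrow> a = m"
  proof (rule predicate_Zorn[of M "\<lambda>a b. b \<le> a"])
    show "partial_order_on M (relation_of (\<lambda>a b. b \<le> a) M)"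
      by (auto simp: partial_order_on_def preorder_on_def refl_on_def trans_def antisym_def
          relation_of_def)
  next
    fix C assume C: "C \<in> Chains (relation_of (\<lambda>a b. b \<le> a) M)"
    have CM: "q \<in> M" if "q \<in> C" for q
      using C that by (auto simp: Chains_def relation_of_def)
    have cmp: "a \<le> b \<or> b \<le> a" if "a \<in> C" "b \<in> C" for a b
      using C that by (auto simp: Chains_def relation_of_def)
    show "\<exists>u\<in>M. \<forall>a\<in>C. u \<le> a"
    proof (cases "C = {}")
      case True
      then show ?thesis using p by (auto simp: M_def)
    next
      case False
      define u where "u = (\<lambda>x. INF q\<in>C. q x)"
      have lower: "- p (- x) \<le> q x" if "q \<in> C" for q x
        using sublinear_ge[of q x] CM[OF that] le_funD[of q p "- x"] unfolding M_def by auto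
      have bdd: "bdd_below ((\<lambda>q. q x) ` C)" for x
        using lower by (intro bdd_belowI2) auto
      have ule: "u x \<le> q x" if "q \<in> C" for q x
        unfolding u_def using cINF_lower[OF bdd that] .
      have uge: "b \<le> u x" if "\<And>q. q \<in> C \<Longrightarrow> b \<le> q x" for b x
        unfolding u_def using False that by (intro cINF_greatest) auto
      have "sublinear u"
      proof (rule sublinearI)
        fix x y
        have *: "u (x + y) \<le> q1 x + q2 y" if q: "q1 \<in> C" "q2 \<in> C" for q1 q2
          using cmp[OF q]
        proof
          assume "q1 \<le> q2"
          then show ?thesis using ule[OF q(1), of "x + y"] sublinear_add[of q1 x y] CM[OF q(1)]
              le_funD[of q1 q2 y] unfolding M_def by auto
        next
          assume "q2 \<le> q1"
          then show ?thesis using ule[OF q(2), of "x + y"] sublinear_add[of q2 x y] CM[OF q(2)]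
              le_funD[of q2 q1 x] unfolding M_def by auto
        qed
        have "u (x + y) - u x \<le> q2 y" if "q2 \<in> C" for q2
          using uge[of "u (x + y) - q2 y" x] *[OF _ that] by (force simp: algebra_simps)
        then have "u (x + y) - u x \<le> u y" by (rule uge)
        then show "u (x + y) \<le> u x + u y" by simp
      next
        fix c :: real and x assume c: "c > 0"
        have "u (c *\<^sub>R x) / c \<le> u x"
        proof (rule uge)
          fix q assume "q \<in> C"
          then have "u (c *\<^sub>R x) \<le> c * q x"
            using ule[of q "c *\<^sub>R x"] CM[of q] sublinear_scale[of q c x] c by (auto simp: M_def)
          then show "u (c *\<^sub>R x) / c \<le> q x" using c by (simp add: field_simps)
        qed
        then show "u (c *\<^sub>R x) \<le> c * u x" using c by (simp add: field_simps)
      qed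
      moreover have "u \<le> p"
        using False ule CM unfolding M_def le_fun_def by (metis (mono_tags, lifting) ex_in_conv mem_Collect_eq order_trans)
      ultimately show ?thesis using ule by (auto simp: M_def le_fun_def)
    qed
  qed
  then show ?thesis unfolding M_def by (auto intro: order_trans)
qed

text \<open>The infimum over \<open>t \<ge> 0\<close> of \<open>p (x + t *\<^sub>R a) - t * p a\<close> pushes \<open>p\<close> down as far as the
prescribed value in the direction \<open>a\<close> permits. This single construction serves twice: it shows
that a minimal sublinear functional is odd, and it makes a dominated linear functional touch \<open>p\<close>
at a chosen point.\<close>

lemma sublinear_tilt:
  assumes p: "sublinear p"
  shows "\<exists>q. sublinear q \<and> q \<le> p \<and> q (- a) \<le> - p a"
proof -
  define g where "g = (\<lambda>x t. p (x + t *\<^sub>R a) - t * p a)"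
  define q where "q = (\<lambda>x. INF t\<in>{0..}. g x t)"
  have pt: "p (t *\<^sub>R a) = t * p a" if "t \<ge> 0" for t
    using that sublinear_scale[OF p, of t a] sublinear_zero[OF p] by (cases "t = 0") auto
  have lower: "- p (- x) \<le> g x t" if "t \<ge> 0" for x t
    using sublinear_add[OF p, of "- x" "x + t *\<^sub>R a"] pt[OF that] by (simp add: g_def)
  have bdd: "bdd_below (g x ` {0..})" for x
    using lower by (intro bdd_belowI2) auto
  have qle: "q x \<le> g x t" if "t \<ge> 0" for x t
    unfolding q_def using that by (intro cINF_lower[OF bdd]) auto
  have qge: "b \<le> q x" if "\<And>t. t \<ge> 0 \<Longrightarrow> b \<le> g x t" for b x
    unfolding q_def using that by (intro cINF_greatest) auto
  have "sublinear q"
  proof (rule sublinearI)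
    fix x y
    have *: "q (x + y) \<le> g x s + g y t" if "s \<ge> 0" "t \<ge> 0" for s t
    proof -
      have "q (x + y) \<le> g (x + y) (s + t)" using that by (intro qle) auto
      also have "\<dots> \<le> g x s + g y t"
        using sublinear_add[OF p, of "x + s *\<^sub>R a" "y + t *\<^sub>R a"]
        by (simp add: g_def algebra_simps)
      finally show ?thesis .
    qed
    have "q (x + y) - q x \<le> g y t" if "t \<ge> 0" for t
      using qge[of "q (x + y) - g y t" x] *[OF _ that] by (force simp: algebra_simps)
    then have "q (x + y) - q x \<le> q y" by (rule qge)
    then show "q (x + y) \<le> q x + q y" by simp
  next
    fix c :: real and x assume c: "c > 0"
    have "q (c *\<^sub>R x) / c \<le> q x"
    proof (rule qge)
      fix t :: real assume "t \<ge> 0"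
      then have "q (c *\<^sub>R x) \<le> g (c *\<^sub>R x) (c * t)" using c by (intro qle) auto
      also have "\<dots> = c * g x t"
        using sublinear_scale[OF p c, of "x + t *\<^sub>R a"] by (simp add: g_def algebra_simps)
      finally show "q (c *\<^sub>R x) / c \<le> g x t" using c by (simp add: field_simps)
    qed
    then show "q (c *\<^sub>R x) \<le> c * q x" using c by (simp add: field_simps)
  qed
  moreover have "q x \<le> p x" for x using qle[of 0 x] by (simp add: g_def)
  moreover have "q (- a) \<le> - p a" using qle[of 1 "- a"] by (simp add: g_def sublinear_zero[OF p])
  ultimately show ?thesis by (auto simp: le_fun_def)
qed

text \<open>A form of the Hahn--Banach theorem: tilt \<open>p\<close> at \<open>a\<close>, then pass to a minimal sublinear functional
below. Tilting a minimal functional changes nothing, so it is odd, and an odd sublinear functional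
is linear.\<close>

theorem sublinear_dominates_linear:
  assumes p: "sublinear p"
  shows "\<exists>f. linear f \<and> (\<forall>x. f x \<le> p x) \<and> f a = p a"
proof -
  obtain p' where p': "sublinear p'" "p' \<le> p" "p' (- a) \<le> - p a"
    using sublinear_tilt[OF p] by blast
  obtain f where f: "sublinear f" "f \<le> p'" and min: "\<And>q. sublinear q \<Longrightarrow> q \<le> f \<Longrightarrow> q = f"
    using minimal_sublinear_exists[OF p'(1)] by blast
  have odd: "f (- x) = - f x" for x
  proof -
    obtain q where "sublinear q" "q \<le> f" "q (- x) \<le> - f x"
      using sublinear_tilt[OF f(1)] by blast
    then have "f (- x) \<le> - f x" using min by metis
    then show ?thesis using sublinear_ge[OF f(1), of "- x"] by simp
  qed
  have add: "f (x + y) = f x + f y" for x y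
    using sublinear_add[OF f(1), of x y] sublinear_add[OF f(1), of "- x" "- y"] odd[of "x + y"]
      odd[of x] odd[of y] by simp
  have "f (c *\<^sub>R x) = c * f x" for c x
  proof (cases "c > 0" "c = 0" rule: bool.exhaust[case_product bool.exhaust])
    case True_True then show ?thesis by simp
  next
    case True_False then show ?thesis using sublinear_scale[OF f(1)] by simp
  next
    case False_True then show ?thesis using sublinear_zero[OF f(1)] by simp
  next
    case False_False
    then show ?thesis using sublinear_scale[OF f(1), of "- c" "- x"] odd[of x] by simp
  qed
  with add have "linear f" by (intro linearI) auto
  moreover have le: "f x \<le> p x" for x using f(2) p'(2) by (meson le_funD order_trans)
  moreover have "f a = p a"
    using le[of a] le_funD[OF f(2), of "- a"] p'(3) odd[of a] by linarith
  ultimately show ?thesis by blast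
qed

corollary norm_dominated_linear_blinfun:
  fixes f :: "'a::real_normed_vector \<Rightarrow> real"
  assumes "linear f" "\<And>x. f x \<le> norm x * K"
  shows "\<exists>\<phi>::'a \<Rightarrow>\<^sub>L real. blinfun_apply \<phi> = f"
proof -
  have "\<bar>f x\<bar> \<le> norm x * K" for x
    using assms(2)[of x] assms(2)[of "- x"] linear_neg[OF assms(1)] by (simp add: abs_le_iff)
  then have "bounded_linear f"
    using assms(1) by (intro bounded_linear_intro[where K = K]) (auto simp: linear_add linear_scale)
  then show ?thesis using bounded_linear_Blinfun_apply by blast
qed

corollary norming_functional:
  fixes a :: "'a::real_normed_vector"
  shows "\<exists>\<phi>::'a \<Rightarrow>\<^sub>L real. blinfun_apply \<phi> a = norm a \<and> (\<forall>x. blinfun_apply \<phi> x \<le> norm x)"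
proof -
  have "sublinear (norm :: 'a \<Rightarrow> real)" by (rule sublinearI) (auto intro: norm_triangle_ineq)
  then obtain f where f: "linear f" "\<And>x. f x \<le> norm (x::'a)" "f a = norm a"
    using sublinear_dominates_linear by blast
  then show ?thesis using norm_dominated_linear_blinfun[of f 1] by auto
qed

text \<open>The distance to a subspace is sublinear and vanishes exactly on its closure; a linear functional
dominated by it vanishes on the subspace, and it can be made positive at a point off the closure.\<close>

corollary separating_functional:
  fixes S :: "'a::real_normed_vector set"
  assumes S: "subspace S" and a: "a \<notin> closure S"
  shows "\<exists>\<phi>::'a \<Rightarrow>\<^sub>L real. blinfun_apply \<phi> a > 0 \<and> (\<forall>x\<in>S. blinfun_apply \<phi> x = 0)"
proof -
  have ne: "S \<noteq> {}" using subspace_0[OF S] by auto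
  have approx: "\<exists>s\<in>S. dist x s < infdist x S + e" if "e > 0" for x e
    using that ne cINF_less_iff[of S "dist x" "infdist x S + e"]
    by (auto simp: infdist_notempty bdd_below_image_dist)
  have sub: "sublinear (\<lambda>x. infdist x S)"
  proof (rule sublinearI)
    fix x y
    show "infdist (x + y) S \<le> infdist x S + infdist y S"
    proof (rule field_le_epsilon)
      fix e :: real assume "e > 0"
      then obtain s t where st: "s \<in> S" "t \<in> S" "dist x s < infdist x S + e/2"
          "dist y t < infdist y S + e/2"
        using approx[of "e/2"] by (meson half_gt_zero)
      have "infdist (x + y) S \<le> dist (x + y) (s + t)"
        using st S by (intro infdist_le subspace_add)
      also have "\<dots> \<le> dist x s + dist y t" by (rule dist_triangle_add)
      finally show "infdist (x + y) S \<le> infdist x S + infdist y S + e" using st by linarith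
    qed
  next
    fix c :: real and x assume c: "c > 0"
    have "infdist (c *\<^sub>R x) S / c \<le> infdist x S"
    proof (rule field_le_epsilon)
      fix e :: real assume "e > 0"
      then obtain s where s: "s \<in> S" "dist x s < infdist x S + e" using approx by blast
      have "infdist (c *\<^sub>R x) S \<le> dist (c *\<^sub>R x) (c *\<^sub>R s)"
        using s S by (intro infdist_le subspace_scale)
      also have "\<dots> = c * dist x s" using c by (simp add: dist_norm flip: scaleR_diff_right)
      finally have "infdist (c *\<^sub>R x) S / c \<le> dist x s" using c by (simp add: field_simps)
      then show "infdist (c *\<^sub>R x) S / c \<le> infdist x S + e" using s by linarith
    qed
    then show "infdist (c *\<^sub>R x) S \<le> c * infdist x S" using c by (simp add: field_simps)
  qed
  obtain f where f: "linear f" "\<And>x. f x \<le> infdist x S" "f a = infdist a S"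
    using sublinear_dominates_linear[OF sub] by blast
  have "infdist x S \<le> norm x * 1" for x
    using infdist_le[OF subspace_0[OF S], of x] by simp
  then obtain \<phi> :: "'a \<Rightarrow>\<^sub>L real" where \<phi>: "blinfun_apply \<phi> = f"
    using norm_dominated_linear_blinfun[OF f(1), of 1] f(2) order_trans by blast
  have "f x = 0" if "x \<in> S" for x
  proof -
    have "f x \<le> 0" "f (- x) \<le> 0"
      using f(2)[of x] f(2)[of "- x"] that subspace_neg[OF S that] by simp_all
    then show ?thesis by (simp add: linear_neg[OF f(1)])
  qed
  moreover have "infdist a S > 0"
    using a ne in_closure_iff_infdist_zero[of S a] infdist_nonneg[of a S] by fastforce
  ultimately show ?thesis using \<phi> f(3) by (intro exI[of _ \<phi>]) simp
qed

section \<open>Weak sequential compactness in reflexive spaces\<close>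

text \<open>The functional \<open>p\<close> in the proof is the upper limit of \<open>\<phi> (x n)\<close>, as a sublinear functional of
\<open>\<phi>\<close> on the dual space. A linear functional dominated by it is a generalised Banach limit, hence an element of
the bidual, and reflexivity turns it into a point \<open>l\<close>. Such a point plays the role of a weak cluster
point of the sequence.\<close>

lemma reflexive_cluster_point:
  fixes x :: "nat \<Rightarrow> 'a::real_normed_vector"
  assumes refl: "reflexive_space TYPE('a)" and bd: "bounded (range x)"
  shows "\<exists>l. \<forall>(\<phi>::'a \<Rightarrow>\<^sub>L real) b. (\<forall>\<^sub>F n in sequentially. \<phi> (x n) \<le> b) \<longrightarrow> \<phi> l \<le> b"
proof -
  obtain K where K: "\<And>n. norm (x n) \<le> K" using bd by (auto simp: bounded_iff)
  define U where "U = (\<lambda>\<phi>::'a \<Rightarrow>\<^sub>L real. {b. \<forall>\<^sub>F n in sequentially. \<phi> (x n) \<le> b})"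
  define p where "p = (\<lambda>\<phi>. Inf (U \<phi>))"
  have abs: "\<bar>\<phi> (x n)\<bar> \<le> norm \<phi> * K" for \<phi> :: "'a \<Rightarrow>\<^sub>L real" and n
    using norm_blinfun[of \<phi> "x n"] mult_left_mono[OF K[of n], of "norm \<phi>"] by simp
  have inU: "norm \<phi> * K \<in> U \<phi>" for \<phi>
    using abs[of \<phi>] by (auto simp: U_def abs_le_iff)
  have lower: "- (norm \<phi> * K) \<le> b" if b: "b \<in> U \<phi>" for b \<phi>
  proof -
    obtain n where "\<phi> (x n) \<le> b"
      using b unfolding U_def mem_Collect_eq eventually_sequentially by (meson order_refl)
    then show ?thesis using abs[of \<phi> n] by linarith
  qed
  have ple: "p \<phi> \<le> b" if "b \<in> U \<phi>" for b \<phi>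
    unfolding p_def using that lower by (intro cInf_lower) (auto simp: bdd_below_def)
  have pge: "b \<le> p \<phi>" if "\<And>c. c \<in> U \<phi> \<Longrightarrow> b \<le> c" for b \<phi>
    unfolding p_def using that inU by (intro cInf_greatest) auto
  have "sublinear p"
  proof (rule sublinearI)
    fix \<phi> \<psi>
    have *: "p (\<phi> + \<psi>) \<le> b + c" if "b \<in> U \<phi>" "c \<in> U \<psi>" for b c
    proof (rule ple)
      show "b + c \<in> U (\<phi> + \<psi>)"
        using that unfolding U_def mem_Collect_eq
        by eventually_elim (simp add: plus_blinfun.rep_eq)
    qed
    have "p (\<phi> + \<psi>) - p \<phi> \<le> c" if "c \<in> U \<psi>" for c
      using pge[of \<phi> "p (\<phi> + \<psi>) - c"] *[OF _ that] by (force simp: algebra_simps)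
    then have "p (\<phi> + \<psi>) - p \<phi> \<le> p \<psi>" by (rule pge)
    then show "p (\<phi> + \<psi>) \<le> p \<phi> + p \<psi>" by simp
  next
    fix c :: real and \<phi> assume c: "c > 0"
    have "p (c *\<^sub>R \<phi>) / c \<le> p \<phi>"
    proof (rule pge)
      fix b assume "b \<in> U \<phi>"
      then have "c * b \<in> U (c *\<^sub>R \<phi>)" using c by (simp add: U_def scaleR_blinfun.rep_eq)
      then show "p (c *\<^sub>R \<phi>) / c \<le> b" using ple c by (simp add: field_simps)
    qed
    then show "p (c *\<^sub>R \<phi>) \<le> c * p \<phi>" using c by (simp add: field_simps)
  qed
  then obtain f where f: "linear f" "\<And>\<phi>. f \<phi> \<le> p \<phi>"
    using sublinear_dominates_linear by blast
  have "f \<phi> \<le> norm \<phi> * K" for \<phi> using f(2)[of \<phi>] ple[OF inU, of \<phi>] by linarith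
  then obtain \<Psi> :: "('a \<Rightarrow>\<^sub>L real) \<Rightarrow>\<^sub>L real" where \<Psi>: "blinfun_apply \<Psi> = f"
    using norm_dominated_linear_blinfun[OF f(1)] by blast
  obtain l where l: "\<And>\<phi>. blinfun_apply \<Psi> \<phi> = blinfun_apply \<phi> l"
    using refl unfolding reflexive_space_def by blast
  have "\<phi> l \<le> b" if "\<forall>\<^sub>F n in sequentially. \<phi> (x n) \<le> b" for \<phi> :: "'a \<Rightarrow>\<^sub>L real" and b
    using ple[of b \<phi>] that f(2)[of \<phi>] l[of \<phi>] \<Psi> by (auto simp: U_def)
  then show ?thesis by blast
qed

lemma countable_dense_in_span:
  fixes A :: "'a::real_normed_vector set"
  assumes "countable A"
  shows "\<exists>E. countable E \<and> E \<noteq> {} \<and> span A \<subseteq> closure E"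
proof -
  define E where "E = (\<Union>t\<in>{t. finite t \<and> t \<subseteq> A}. (\<lambda>q. \<Sum>a\<in>t. q a *\<^sub>R a) ` PiE t (\<lambda>_. \<rat>))"
  have "countable E"
    unfolding E_def using assms
    by (intro countable_UN countable_Collect_finite_subset countable_image countable_PiE)
       (auto simp: countable_rat)
  moreover have "span A \<subseteq> closure E"
  proof
    fix y assume "y \<in> span A"
    then obtain t r where t: "finite t" "t \<subseteq> A" and y: "y = (\<Sum>a\<in>t. r a *\<^sub>R a)"
      unfolding span_explicit by blast
    have "\<exists>q. (\<forall>n. q n \<in> \<rat>) \<and> q \<longlonglongrightarrow> z" for z :: real
      using closure_sequential[of z "\<rat>"] Rats_closure_real by auto
    then obtain q where q: "\<And>z n. q z n \<in> \<rat>" "\<And>z::real. q z \<longlonglongrightarrow> z" by metis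
    define w where "w n = (\<Sum>a\<in>t. restrict (\<lambda>a. q (r a) n) t a *\<^sub>R a)" for n
    have "w n \<in> E" for n
      unfolding E_def w_def using t q by (intro UN_I[of t] imageI) auto
    moreover have "w \<longlonglongrightarrow> y"
      unfolding w_def y using q(2) by (auto intro!: tendsto_sum tendsto_scaleR)
    ultimately show "y \<in> closure E" unfolding closure_sequential by blast
  qed
  moreover have "E \<noteq> {}" using \<open>span A \<subseteq> closure E\<close> span_zero[of A] by auto
  ultimately show ?thesis by blast
qed

text \<open>The dual space need not be separable a priori, so a diagonal argument over a dense set of
functionals is not available. Instead the diagonal sequence is formed over countably many functionals
\<open>\<psi> k\<close> that norm a countable dense set of the span \<open>S\<close> of the sequence; these separate the points of
\<open>closure S\<close>. Every cluster point of a further subsequence lies in \<open>closure S\<close> and has the same values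
under all \<open>\<psi> k\<close>, so there is only one cluster point, and the diagonal sequence converges weakly to
it.\<close>

theorem reflexive_weakly_sequentially_compact:
  fixes x :: "nat \<Rightarrow> 'a::real_normed_vector"
  assumes refl: "reflexive_space TYPE('a)" and bd: "bounded (range x)"
  shows "\<exists>l r. strict_mono r \<and> weak_limit (x \<circ> r) l"
proof -
  define S where "S = span (range x)"
  obtain E where E: "countable E" "E \<noteq> {}" "S \<subseteq> closure E"
    using countable_dense_in_span[of "range x"] by (auto simp: S_def)
  define e where "e = from_nat_into E"
  have e: "range e = E" using E by (simp add: e_def range_from_nat_into)
  have "\<forall>k. \<exists>\<phi>::'a \<Rightarrow>\<^sub>L real. \<phi> (e k) = norm (e k) \<and> (\<forall>x. \<phi> x \<le> norm x)"
    using norming_functional by blast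
  then obtain \<psi> :: "nat \<Rightarrow> 'a \<Rightarrow>\<^sub>L real" where \<psi>: "\<And>k. \<psi> k (e k) = norm (e k)"
      "\<And>k y. \<psi> k y \<le> norm y"
    by metis
  \<comment> \<open>If \<open>e k\<close> is within \<open>norm y / 2\<close> of \<open>y\<close>, then \<open>\<psi> k y\<close> cannot vanish, since \<open>\<psi> k\<close> norms \<open>e k\<close>.\<close>
  have total: "y = 0" if y: "y \<in> closure S" and 0: "\<And>k. \<psi> k y = 0" for y
  proof (rule ccontr)
    assume "y \<noteq> 0"
    have "y \<in> closure E" using y E(3) closure_minimal by blast
    then obtain k where k: "dist (e k) y < norm y / 2"
      using e \<open>y \<noteq> 0\<close> unfolding closure_approachable by (metis half_gt_zero imageE zero_less_norm_iff)
    have "norm (e k) = \<psi> k (e k - y)" using \<psi>(1) 0 by (simp add: blinfun.diff_right)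
    also have "\<dots> \<le> dist (e k) y" using \<psi>(2) by (simp add: dist_norm)
    finally show False using k norm_triangle_ineq2[of y "e k"] by (simp add: dist_norm norm_minus_commute)
  qed
  have bdd: "bounded (range (\<lambda>n. \<phi> (x (s n))))" for \<phi> :: "'a \<Rightarrow>\<^sub>L real" and s
  proof -
    obtain K where "\<And>n. norm (x n) \<le> K" using bd by (auto simp: bounded_iff)
    then have "norm (\<phi> (x n)) \<le> norm \<phi> * K" for n
      using norm_blinfun[of \<phi> "x n"] by (meson mult_left_mono norm_ge_zero order_trans)
    then show ?thesis by (auto simp: bounded_iff)
  qed
  interpret subseqs "\<lambda>k s. convergent (\<lambda>n. \<psi> k (x (s n)))"
  proof
    fix k and s :: "nat \<Rightarrow> nat"
    obtain l r where "strict_mono r" "((\<lambda>n. \<psi> k (x (s n))) \<circ> r) \<longlonglongrightarrow> l"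
      using bounded_imp_convergent_subsequence[OF bdd] by blast
    then show "\<exists>r. strict_mono r \<and> convergent (\<lambda>n. \<psi> k (x ((s \<circ> r) n)))"
      by (auto simp: convergent_def o_def)
  qed
  define r where "r = diagseq"
  have r: "strict_mono r" unfolding r_def by (rule subseq_diagseq)
  have conv: "convergent (\<lambda>n. \<psi> k (x (r n)))" for k
  proof -
    have "convergent (\<lambda>n. \<psi> k (x ((diagseq \<circ> (+) (Suc k)) n)))"
    proof (rule diagseq_holds)
      fix r s :: "nat \<Rightarrow> nat" and n
      assume "strict_mono r" "convergent (\<lambda>m. \<psi> n (x (s m)))"
      then show "convergent (\<lambda>m. \<psi> n (x ((s \<circ> r) m)))"
        using convergent_subseq_convergent[of "\<lambda>m. \<psi> n (x (s m))" r] by (simp add: o_def)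
    qed
    then have "convergent (\<lambda>n. \<psi> k (x (r (n + Suc k))))" by (simp add: r_def o_def add.commute)
    then show ?thesis
      using convergent_ignore_initial_segment[of "\<lambda>n. \<psi> k (x (r n))"] by blast
  qed
  have cluster: "\<exists>l\<in>closure S. \<forall>(\<phi>::'a \<Rightarrow>\<^sub>L real) a. (\<lambda>n. \<phi> (x (s n))) \<longlonglongrightarrow> a \<longrightarrow> \<phi> l = a" for s
  proof -
    have "bounded (range (\<lambda>n. x (s n)))" using bd by (rule bounded_subset) auto
    then obtain l where l: "\<And>(\<phi>::'a \<Rightarrow>\<^sub>L real) b. (\<forall>\<^sub>F n in sequentially. \<phi> (x (s n)) \<le> b) \<Longrightarrow> \<phi> l \<le> b"
      using reflexive_cluster_point[OF refl] by blast
    have "l \<in> closure S"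
    proof (rule ccontr)
      assume "l \<notin> closure S"
      then obtain \<phi> :: "'a \<Rightarrow>\<^sub>L real" where \<phi>: "\<phi> l > 0" "\<And>y. y \<in> S \<Longrightarrow> \<phi> y = 0"
        using separating_functional[of S l] by (auto simp: S_def)
      have "x n \<in> S" for n by (auto simp: S_def intro: span_base)
      then show False using l[of \<phi> 0] \<phi> by simp
    qed
    moreover have "\<phi> l = a" if a: "(\<lambda>n. \<phi> (x (s n))) \<longlonglongrightarrow> a" for \<phi> :: "'a \<Rightarrow>\<^sub>L real" and a
    proof (rule antisym; rule field_le_epsilon)
      fix \<epsilon> :: real assume "\<epsilon> > 0"
      then have "\<forall>\<^sub>F n in sequentially. \<phi> (x (s n)) < a + \<epsilon>" by (intro order_tendstoD[OF a]) auto
      then show "\<phi> l \<le> a + \<epsilon>" by (intro l) (auto elim: eventually_mono)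
    next
      fix \<epsilon> :: real assume "\<epsilon> > 0"
      then have "\<forall>\<^sub>F n in sequentially. a - \<epsilon> < \<phi> (x (s n))" by (intro order_tendstoD[OF a]) auto
      then have "(- \<phi>) l \<le> \<epsilon> - a" by (intro l) (auto elim: eventually_mono simp: uminus_blinfun.rep_eq)
      then show "a \<le> \<phi> l + \<epsilon>" by (simp add: uminus_blinfun.rep_eq)
    qed
    ultimately show ?thesis by blast
  qed
  obtain l where l: "l \<in> closure S"
      "\<And>(\<phi>::'a \<Rightarrow>\<^sub>L real) a. (\<lambda>n. \<phi> (x (r n))) \<longlonglongrightarrow> a \<Longrightarrow> \<phi> l = a"
    using cluster by blast
  have "(\<lambda>n. \<phi> (x (r n))) \<longlonglongrightarrow> \<phi> l" for \<phi> :: "'a \<Rightarrow>\<^sub>L real"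
  proof (rule ccontr)
    assume "\<not> ?thesis"
    then obtain \<epsilon> where \<epsilon>: "\<epsilon> > 0" "\<exists>\<^sub>F n in sequentially. dist (\<phi> (x (r n))) (\<phi> l) \<ge> \<epsilon>"
      unfolding tendsto_iff frequently_def by (auto simp only: not_le)
    \<comment> \<open>A subsequence staying away from \<open>\<phi> l\<close> has its own cluster point, which must again be \<open>l\<close>.\<close>
    define B where "B = {n. dist (\<phi> (x (r n))) (\<phi> l) \<ge> \<epsilon>}"
    have "infinite B" using \<epsilon>(2) by (simp add: B_def frequently_cofinite cofinite_eq_sequentially[symmetric])
    define s where "s = enumerate B"
    have s: "strict_mono s" "\<And>n. s n \<in> B"
      using \<open>infinite B\<close> by (auto simp: s_def strict_mono_enumerate enumerate_in_set)
    obtain a s' where s': "strict_mono s'" "((\<lambda>n. \<phi> (x ((r \<circ> s) n))) \<circ> s') \<longlonglongrightarrow> a"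
      using bounded_imp_convergent_subsequence[OF bdd] by blast
    then have a: "(\<lambda>n. \<phi> (x ((r \<circ> s \<circ> s') n))) \<longlonglongrightarrow> a" by (simp add: o_def)
    obtain l' where l': "l' \<in> closure S"
        "\<And>(\<phi>::'a \<Rightarrow>\<^sub>L real) a. (\<lambda>n. \<phi> (x ((r \<circ> s \<circ> s') n))) \<longlonglongrightarrow> a \<Longrightarrow> \<phi> l' = a"
      using cluster by blast
    have "\<psi> k (l' - l) = 0" for k
    proof -
      obtain b where b: "(\<lambda>n. \<psi> k (x (r n))) \<longlonglongrightarrow> b" using conv by (auto simp: convergent_def)
      then have "((\<lambda>n. \<psi> k (x (r n))) \<circ> (s \<circ> s')) \<longlonglongrightarrow> b"
        using s(1) s'(1) by (intro LIMSEQ_subseq_LIMSEQ strict_mono_o)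
      then show ?thesis using l(2)[OF b] l'(2)[of "\<psi> k" b] by (simp add: o_def blinfun.diff_right)
    qed
    moreover have "l' - l \<in> closure S"
    proof -
      obtain f g where "\<And>n. f n \<in> S" "f \<longlonglongrightarrow> l'" "\<And>n. g n \<in> S" "g \<longlonglongrightarrow> l"
        using l(1) l'(1) unfolding closure_sequential by blast
      then show ?thesis unfolding closure_sequential
        by (intro exI[of _ "\<lambda>n. f n - g n"]) (auto simp: S_def intro: span_diff tendsto_diff)
    qed
    ultimately have "l' = l" using total by fastforce
    then have "(\<lambda>n. \<phi> (x ((r \<circ> s \<circ> s') n))) \<longlonglongrightarrow> \<phi> l" using l'(2)[OF a] a by simp
    then have "(\<lambda>n. dist (\<phi> (x (r (s (s' n))))) (\<phi> l)) \<longlonglongrightarrow> 0"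
      by (subst (asm) tendsto_dist_iff) (simp add: o_def)
    then have "\<epsilon> \<le> 0"
      using s(2) by (intro LIMSEQ_le_const[of _ 0 \<epsilon>]) (auto simp: B_def)
    then show False using \<epsilon>(1) by simp
  qed
  then show ?thesis using r by (auto simp: weak_limit_def)
qed

lemma weak_limit_in_closed_subspace:
  assumes "subspace S" "closed S" "\<And>n. v n \<in> S" "weak_limit v l"
  shows "l \<in> S"
proof (rule ccontr)
  assume "l \<notin> S"
  then obtain \<phi> :: "'a \<Rightarrow>\<^sub>L real" where \<phi>: "\<phi> l > 0" "\<And>x. x \<in> S \<Longrightarrow> \<phi> x = 0"
    using separating_functional[of S l] assms by (auto simp: closure_closed)
  then have "(\<lambda>n. 0) \<longlonglongrightarrow> \<phi> l"
    using assms(3,4) unfolding weak_limit_def by (metis (no_types, lifting) ext)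
  then show False using \<phi>(1) LIMSEQ_unique[OF tendsto_const] by fastforce
qed

section \<open>Restriction to lines and half-spaces\<close>

lemma C1_functional_has_derivative:
  assumes "C1_functional f"
  shows "(f has_derivative frechet_derivative f (at u)) (at u)"
  using assms unfolding C1_functional_def
  by (metis differentiableI frechet_derivative_works)

lemma has_derivative_along_line:
  fixes f :: "'a::real_normed_vector \<Rightarrow> real"
  assumes "(f has_derivative f') (at u)"
  shows "((\<lambda>r. f (u + r *\<^sub>R h)) has_real_derivative f' h) (at 0)"
proof -
  have "((\<lambda>r. u + r *\<^sub>R h) has_derivative (\<lambda>r. r *\<^sub>R h)) (at 0)"
    by (auto intro!: derivative_eq_intros)
  then have "(f \<circ> (\<lambda>r. u + r *\<^sub>R h) has_derivative f' \<circ> (\<lambda>r. r *\<^sub>R h)) (at 0)"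
    using assms by (intro diff_chain_at) auto
  moreover have "f' \<circ> (\<lambda>r. r *\<^sub>R h) = (*) (f' h)"
    using linear_scale[OF has_derivative_linear[OF assms]] by (auto simp: o_def mult.commute)
  ultimately show ?thesis by (simp add: has_field_derivative_def o_def)
qed

text \<open>For a subspace \<open>S\<close> and \<open>u \<notin> S\<close> this is the half-space of \<open>\<real>u \<oplus> S\<close> with boundary \<open>S\<close> that
contains \<open>u\<close>; it depends only on the direction of \<open>u\<close> modulo \<open>S\<close>.\<close>

definition halfspace :: "'a::real_vector set \<Rightarrow> 'a \<Rightarrow> 'a set" where
  "halfspace S u = {t *\<^sub>R u + v |t v. t \<ge> 0 \<and> v \<in> S}"

lemma halfspaceI: "t \<ge> 0 \<Longrightarrow> v \<in> S \<Longrightarrow> t *\<^sub>R u + v \<in> halfspace S u"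
  by (auto simp: halfspace_def)

lemma halfspace_shift:
  assumes S: "subspace S" and c: "c > 0" and v: "v0 \<in> S"
  shows "halfspace S (c *\<^sub>R e + v0) = halfspace S e"
proof (intro equalityI subsetI)
  fix w assume "w \<in> halfspace S (c *\<^sub>R e + v0)"
  then obtain t v where w: "w = t *\<^sub>R (c *\<^sub>R e + v0) + v" "t \<ge> 0" "v \<in> S"
    by (auto simp: halfspace_def)
  then have "w = (t * c) *\<^sub>R e + (t *\<^sub>R v0 + v)" by (simp add: algebra_simps)
  also have "\<dots> \<in> halfspace S e"
    using w c v S by (intro halfspaceI subspace_add subspace_scale) auto
  finally show "w \<in> halfspace S e" .
next
  fix w assume "w \<in> halfspace S e"
  then obtain t v where w: "w = t *\<^sub>R e + v" "t \<ge> 0" "v \<in> S"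
    by (auto simp: halfspace_def)
  then have "w = (t / c) *\<^sub>R (c *\<^sub>R e + v0) + (v - (t / c) *\<^sub>R v0)"
    using c by (simp add: algebra_simps)
  also have "\<dots> \<in> halfspace S (c *\<^sub>R e + v0)"
    using w c v S by (intro halfspaceI subspace_diff subspace_scale) auto
  finally show "w \<in> halfspace S (c *\<^sub>R e + v0)" .
qed

lemma halfspace_eq:
  assumes S: "subspace S" and w: "w \<in> halfspace S u" "w \<notin> S"
  shows "halfspace S w = halfspace S u"
proof -
  obtain t v where tv: "w = t *\<^sub>R u + v" "t \<ge> 0" "v \<in> S"
    using w(1) by (auto simp: halfspace_def)
  moreover have "t \<noteq> 0" using tv w(2) by auto
  ultimately show ?thesis using halfspace_shift[OF S, of t v u] by simp
qed

locale norm_splitting =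
  fixes Xp Xt :: "'a::real_normed_vector set"
  assumes dec: "topological_direct_sum Xp Xt"
    and norm_split: "(norm u)\<^sup>2 = (norm (component Xp Xt u))\<^sup>2 + (norm (component Xt Xp u))\<^sup>2"
begin

abbreviation P :: "'a \<Rightarrow> 'a" where "P \<equiv> component Xp Xt"

lemma subspace_Xp: "subspace Xp" and subspace_Xt: "subspace Xt"
  using dec by (auto simp: topological_direct_sum_def)

lemma ex1_P: "\<exists>!y. y \<in> Xp \<and> u - y \<in> Xt"
  using dec by (auto simp: topological_direct_sum_def)

lemma P_in: "P u \<in> Xp" and P_diff: "u - P u \<in> Xt"
  using theI'[OF ex1_P[of u]] by (auto simp: component_def)

lemma P_eq: "y \<in> Xp \<Longrightarrow> u - y \<in> Xt \<Longrightarrow> P u = y"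
  using ex1_P[of u] P_in P_diff by blast

lemma P_comb: "e \<in> Xp \<Longrightarrow> v \<in> Xt \<Longrightarrow> P (t *\<^sub>R e + v) = t *\<^sub>R e"
  by (rule P_eq) (auto intro: subspace_scale[OF subspace_Xp])

lemma P_scale_add: "v \<in> Xt \<Longrightarrow> P (t *\<^sub>R u + v) = t *\<^sub>R P u"
proof (rule P_eq)
  assume "v \<in> Xt"
  then have "t *\<^sub>R (u - P u) + v \<in> Xt"
    using P_diff by (intro subspace_add subspace_scale subspace_Xt)
  then show "t *\<^sub>R u + v - t *\<^sub>R P u \<in> Xt" by (simp add: algebra_simps)
qed (auto intro: subspace_scale[OF subspace_Xp] P_in)

lemma Xt_iff: "u \<in> Xt \<longleftrightarrow> P u = 0"
proof
  show "u \<in> Xt \<Longrightarrow> P u = 0" by (rule P_eq) (auto intro: subspace_0[OF subspace_Xp])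
  show "P u = 0 \<Longrightarrow> u \<in> Xt" using P_diff[of u] by simp
qed

lemma component_Xt: "component Xt Xp u = u - P u"
  unfolding component_def[of Xt]
proof (rule the_equality)
  show "u - P u \<in> Xt \<and> u - (u - P u) \<in> Xp" using P_diff P_in by simp
  fix y assume "y \<in> Xt \<and> u - y \<in> Xp"
  then have "P u = u - y" by (intro P_eq) auto
  then show "y = u - P u" by simp
qed

lemma norm_P_le: "norm (P u) \<le> norm u"
  using norm_split[of u] zero_le_power2[of "norm (component Xt Xp u)"]
  by (intro power2_le_imp_le[OF _ norm_ge_zero]) linarith

lemma closed_Xt: "closed Xt"
proof -
  have "Xt = P -` {0}" using Xt_iff by auto
  moreover have "continuous_on UNIV P" using dec by (simp add: topological_direct_sum_def)
  ultimately show ?thesis using closed_vimage[of "{0}" P] by simp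
qed

text \<open>Each half-space is represented by a unit vector of \<open>Xp\<close>, so that coordinates \<open>t *\<^sub>R e + v\<close> satisfy
\<open>norm (P (t *\<^sub>R e + v)) = \<bar>t\<bar>\<close>.\<close>

lemma sgn_P:
  assumes "u \<notin> Xt"
  shows "sgn (P u) \<in> Xp" "norm (sgn (P u)) = 1" "halfspace Xt u = halfspace Xt (sgn (P u))"
proof -
  have ne: "norm (P u) > 0" using assms Xt_iff by simp
  show "sgn (P u) \<in> Xp" by (simp add: sgn_div_norm subspace_scale[OF subspace_Xp P_in])
  show "norm (sgn (P u)) = 1" using ne by (simp add: norm_sgn)
  show "halfspace Xt u = halfspace Xt (sgn (P u))"
    using halfspace_shift[OF subspace_Xt ne P_diff[of u], of "sgn (P u)"] ne
    by (simp add: sgn_div_norm)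
qed

end

section \<open>The Nehari--Pankov set of a single functional\<close>

locale nehari_functional = norm_splitting Xp Xt
  for Xp Xt :: "'a::real_normed_vector set" +
  fixes I J :: "'a \<Rightarrow> real"
  assumes reflexive: "reflexive_space TYPE('a)"
    and nontrivial: "Xp \<noteq> {0}"
    and J_C1: "C1_functional J"
    and J_form: "J u = 1 / 2 * (norm (P u))\<^sup>2 - I u"
    and A1: "cond_A1 I"
    and A2: "cond_A2 Xp Xt I"
    and A4: "cond_A4 Xp J"
    and B1: "cond_B1 Xp Xt I"
    and B2: "cond_B2 Xp Xt I"
    and B3: "cond_B3 Xt J I"
    and C2: "cond_C2 Xp Xt I"
begin

abbreviation N :: "'a set" where "N \<equiv> nehari_pankov_set Xt J"

lemma I_nonneg: "I u \<ge> 0"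
  using A1 by (auto simp: cond_A1_def)

lemma J_comb:
  assumes "e \<in> Xp" "norm e = 1" "v \<in> Xt"
  shows "J (t *\<^sub>R e + v) = t\<^sup>2 / 2 - I (t *\<^sub>R e + v)"
  using assms by (simp add: J_form P_comb)

text \<open>On the line through \<open>u\<close> in a direction of \<open>\<real>u \<oplus> Xt\<close>, the quadratic part of \<open>J\<close> is an explicit
polynomial in the line parameter, because \<open>P\<close> only rescales \<open>P u\<close> there. Criticality of \<open>J\<close> therefore
determines the derivative of \<open>I\<close> without differentiating the norm of \<open>Xp\<close>.\<close>

lemma derivative_I_on_nehari:
  assumes u: "u \<in> N" and v: "v \<in> Xt"
  shows "frechet_derivative I (at u) (s *\<^sub>R u + v) = s * (norm (P u))\<^sup>2"
proof -
  let ?h = "s *\<^sub>R u + v"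
  have "frechet_derivative J (at u) ?h = 0" using u v by (auto simp: nehari_pankov_set_def)
  then have dJ: "((\<lambda>r. J (u + r *\<^sub>R ?h)) has_real_derivative 0) (at 0)"
    using has_derivative_along_line[OF C1_functional_has_derivative[OF J_C1], of u ?h] by simp
  have "C1_functional I" using A1 by (simp add: cond_A1_def)
  then have dI: "((\<lambda>r. I (u + r *\<^sub>R ?h)) has_real_derivative frechet_derivative I (at u) ?h) (at 0)"
    by (intro has_derivative_along_line C1_functional_has_derivative)
  have "I (u + r *\<^sub>R ?h) = 1/2 * (1 + r * s)\<^sup>2 * (norm (P u))\<^sup>2 - J (u + r *\<^sub>R ?h)" for r
  proof -
    have "u + r *\<^sub>R ?h = (1 + r * s) *\<^sub>R u + r *\<^sub>R v" by (simp add: algebra_simps)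
    then have "P (u + r *\<^sub>R ?h) = (1 + r * s) *\<^sub>R P u"
      using P_scale_add[of "r *\<^sub>R v" "1 + r * s" u] v subspace_scale[OF subspace_Xt] by simp
    then show ?thesis by (simp add: J_form power_mult_distrib)
  qed
  moreover have "((\<lambda>r. 1/2 * (1 + r * s)\<^sup>2 * (norm (P u))\<^sup>2 - J (u + r *\<^sub>R ?h))
      has_real_derivative s * (norm (P u))\<^sup>2 - 0) (at 0)"
    by (rule DERIV_diff[OF _ dJ]) (auto intro!: derivative_eq_intros)
  ultimately show ?thesis using DERIV_unique[OF dI] by simp
qed

text \<open>Inserting the values of the derivative of \<open>I\<close> into (B3) turns its left-hand side into exactly
\<open>J (t *\<^sub>R u + v) - J u\<close>.\<close>

lemma nehari_maximises:
  assumes u: "u \<in> N" and w: "w \<in> halfspace Xt u"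
  shows "J w \<le> J u"
proof (cases "u = w")
  case False
  obtain t v where tv: "w = t *\<^sub>R u + v" "t \<ge> 0" "v \<in> Xt"
    using w by (auto simp: halfspace_def)
  have "frechet_derivative I (at u) u = (norm (P u))\<^sup>2"
    using derivative_I_on_nehari[OF u subspace_0[OF subspace_Xt], of 1] by simp
  moreover have "frechet_derivative I (at u) v = 0"
    using derivative_I_on_nehari[OF u tv(3), of 0] by simp
  ultimately have "(t\<^sup>2 - 1) / 2 * (norm (P u))\<^sup>2 + I u - I w < 0"
    using B3 u tv False unfolding cond_B3_def by fastforce
  moreover have "(norm (P w))\<^sup>2 = t\<^sup>2 * (norm (P u))\<^sup>2"
    using tv P_scale_add[of v t u] by (simp add: power_mult_distrib)
  ultimately show ?thesis by (simp add: J_form field_simps)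
qed simp

text \<open>Points of the half-space away from its boundary are interior to \<open>\<real>w \<oplus> Xt\<close>: moving from \<open>w\<close> along
\<open>s *\<^sub>R w + v\<close> by a parameter smaller than \<open>1 / (\<bar>s\<bar> + 1)\<close> keeps the coefficient of \<open>w\<close>
nonnegative.\<close>

lemma maximiser_in_nehari:
  assumes w: "w \<notin> Xt" and max: "\<And>y. y \<in> halfspace Xt w \<Longrightarrow> J y \<le> J w"
  shows "w \<in> N"
proof -
  have "frechet_derivative J (at w) (s *\<^sub>R w + v) = 0" if v: "v \<in> Xt" for s v
  proof (rule DERIV_local_max)
    show "((\<lambda>r. J (w + r *\<^sub>R (s *\<^sub>R w + v))) has_real_derivative
        frechet_derivative J (at w) (s *\<^sub>R w + v)) (at 0)"
      by (intro has_derivative_along_line C1_functional_has_derivative J_C1)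
    show "0 < 1 / (\<bar>s\<bar> + 1)" by simp
    show "\<forall>r. \<bar>0 - r\<bar> < 1 / (\<bar>s\<bar> + 1) \<longrightarrow>
        J (w + r *\<^sub>R (s *\<^sub>R w + v)) \<le> J (w + 0 *\<^sub>R (s *\<^sub>R w + v))"
    proof (intro allI impI)
      fix r assume "\<bar>0 - r\<bar> < 1 / (\<bar>s\<bar> + 1)"
      then have "\<bar>r\<bar> * (\<bar>s\<bar> + 1) < 1" by (simp add: field_simps)
      then have "\<bar>r * s\<bar> \<le> 1" by (simp add: abs_mult algebra_simps)
      then have "(1 + r * s) *\<^sub>R w + r *\<^sub>R v \<in> halfspace Xt w"
        using v by (intro halfspaceI subspace_scale[OF subspace_Xt]) auto
      then show "J (w + r *\<^sub>R (s *\<^sub>R w + v)) \<le> J (w + 0 *\<^sub>R (s *\<^sub>R w + v))"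
        using max by (simp add: algebra_simps)
    qed
  qed
  then show ?thesis using w by (auto simp: nehari_pankov_set_def)
qed

lemma sphere_lower_bound:
  obtains r d where "r > 0" "d > 0" "\<And>e. e \<in> Xp \<Longrightarrow> norm e = 1 \<Longrightarrow> d \<le> J (r *\<^sub>R e)"
proof -
  obtain r where r: "r > 0" "(INF u\<in>{u \<in> Xp. norm u = r}. ereal (J u)) > 0"
    using A4 by (auto simp: cond_A4_def)
  obtain d where d: "0 < ereal d" "ereal d < (INF u\<in>{u \<in> Xp. norm u = r}. ereal (J u))"
    using ereal_dense2[OF r(2)] by auto
  have "d \<le> J (r *\<^sub>R e)" if "e \<in> Xp" "norm e = 1" for e
  proof -
    have "(INF u\<in>{u \<in> Xp. norm u = r}. ereal (J u)) \<le> ereal (J (r *\<^sub>R e))"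
      using that r(1) by (intro INF_lower) (auto intro: subspace_scale[OF subspace_Xp])
    with d(2) have "ereal d < ereal (J (r *\<^sub>R e))" by (rule less_le_trans)
    then show ?thesis by simp
  qed
  with that r(1) d(1) show thesis by simp
qed

text \<open>The compactness device of the whole argument, uniform over a set \<open>E\<close> of directions. Along an
unbounded sequence \<open>w n = t n *\<^sub>R e n + v n\<close> with \<open>J (w n) \<ge> 0\<close> one has \<open>I (w n) \<le> (t n)\<^sup>2 / 2\<close>, so
(B1) forces \<open>t n\<close> to infinity; but then (C2) makes \<open>I (w n) / (t n)\<^sup>2\<close> unbounded. Condition (C2)
asks for a lower bound at every scale greater than one, whereas here it is known only for scales
beyond \<open>R\<close>: the directions are therefore stretched by the factor \<open>R'\<close>, and \<open>t n\<close> is divided by it.\<close>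

lemma superlevel_bounded:
  assumes E: "\<And>e. e \<in> E \<Longrightarrow> e \<in> Xp \<and> norm e = 1"
    and R: "\<And>e s. e \<in> E \<Longrightarrow> s > R \<Longrightarrow> I (s *\<^sub>R e) \<ge> 1"
  obtains M where "\<And>e w. e \<in> E \<Longrightarrow> w \<in> halfspace Xt e \<Longrightarrow> J w \<ge> 0 \<Longrightarrow> norm w \<le> M"
proof (rule ccontr)
  assume "\<not> thesis"
  with that have "\<And>M. \<exists>e w. e \<in> E \<and> w \<in> halfspace Xt e \<and> J w \<ge> 0 \<and> \<not> norm w \<le> M" by metis
  then have "\<forall>n. \<exists>e t v. e \<in> E \<and> t \<ge> 0 \<and> v \<in> Xt \<and> J (t *\<^sub>R e + v) \<ge> 0 \<and> norm (t *\<^sub>R e + v) > real n"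
    unfolding halfspace_def by (simp add: not_le) metis
  then obtain e t v where *: "\<And>n. e n \<in> E" "\<And>n. t n \<ge> (0::real)" "\<And>n. v n \<in> Xt"
      "\<And>n. J (t n *\<^sub>R e n + v n) \<ge> 0" "\<And>n. norm (t n *\<^sub>R e n + v n) > real n"
    by metis
  define w where "w n = t n *\<^sub>R e n + v n" for n
  have e: "e n \<in> Xp" "norm (e n) = 1" for n using E *(1) by auto
  have Pw: "P (w n) = t n *\<^sub>R e n" for n unfolding w_def using e *(3) by (intro P_comb)
  have Iw: "I (w n) \<le> (t n)\<^sup>2 / 2" for n
    using *(4)[of n] J_comb[OF e[of n] *(3)[of n], of "t n"] by (simp add: w_def)
  have "filterlim (\<lambda>n. norm (w n)) at_top sequentially"
    using *(5) by (intro filterlim_at_top_mono[OF filterlim_real_sequentially])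
      (auto simp: w_def less_imp_le)
  then have "filterlim w at_infinity sequentially"
    by (rule filterlim_norm_at_top_imp_at_infinity)
  then have B: "filterlim (\<lambda>n. norm (P (w n)) + I (w n)) at_top sequentially"
    using B1 unfolding cond_B1_def by (rule filterlim_compose[rotated])
  \<comment> \<open>The function \<open>Z + Z\<^sup>2 / 2\<close> is increasing on nonnegative \<open>Z\<close>, and its value at \<open>t n\<close> dominates the quantity in (B1).\<close>
  have t: "filterlim t at_top sequentially"
    unfolding filterlim_at_top_ge[of _ _ 0]
  proof (intro allI impI)
    fix Z :: real assume "Z \<ge> 0"
    have "\<forall>\<^sub>F n in sequentially. norm (P (w n)) + I (w n) \<ge> Z + Z\<^sup>2 / 2"
      using B by (simp add: filterlim_at_top)
    then show "\<forall>\<^sub>F n in sequentially. Z \<le> t n"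
    proof eventually_elim
      case (elim n)
      then have "Z + Z\<^sup>2 / 2 \<le> t n + (t n)\<^sup>2 / 2"
        using Iw[of n] Pw[of n] e(2)[of n] *(2)[of n] by simp
      moreover have "t n + (t n)\<^sup>2 / 2 < Z + Z\<^sup>2 / 2" if "t n < Z"
        using that *(2)[of n] power_strict_mono[of "t n" Z 2] by simp
      ultimately show ?case by linarith
    qed
  qed
  define R' where "R' = max R 1"
  have R': "R' > 0" "R \<le> R'" by (auto simp: R'_def)
  define u where "u n = R' *\<^sub>R e n + (R' / t n) *\<^sub>R v n" for n
  have Pu: "P (u n) = R' *\<^sub>R e n" for n
    unfolding u_def using e *(3) by (intro P_comb subspace_scale[OF subspace_Xt])
  have "1 \<le> \<bar>I (s *\<^sub>R P (u n))\<bar>" if "s > 1" for s n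
  proof -
    have "s * R' > 1 * R'" using that R' by (intro mult_strict_right_mono)
    then have "1 \<le> I ((s * R') *\<^sub>R e n)" using R' by (intro R *(1)) linarith
    then show ?thesis by (simp add: Pu)
  qed
  then have "\<forall>s>1. \<exists>\<delta>>0. \<forall>n. \<bar>I (s *\<^sub>R P (u n))\<bar> \<ge> \<delta>"
    by (intro allI impI exI[of _ 1]) auto
  moreover have "filterlim (\<lambda>n. t n / R') at_top sequentially"
    using filterlim_at_top_mult_tendsto_pos[OF tendsto_const[of "1 / R'"] _ t] R' by simp
  ultimately have "filterlim (\<lambda>n. I ((t n / R') *\<^sub>R u n) / (t n / R')\<^sup>2) at_top sequentially"
    using C2 unfolding cond_C2_def by blast
  then have "\<forall>\<^sub>F n in sequentially. I ((t n / R') *\<^sub>R u n) / (t n / R')\<^sup>2 \<ge> R'\<^sup>2"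
    by (simp add: filterlim_at_top)
  moreover have "\<forall>\<^sub>F n in sequentially. t n > 0"
    using t by (simp add: filterlim_at_top_dense)
  ultimately have "\<forall>\<^sub>F n in sequentially. False"
  proof eventually_elim
    case (elim n)
    have "(t n / R') *\<^sub>R u n = w n" using elim(2) R' by (simp add: u_def w_def algebra_simps)
    then have "R'\<^sup>2 * (t n / R')\<^sup>2 \<le> I (w n)"
      using elim R' by (simp add: pos_le_divide_eq)
    then have "(t n)\<^sup>2 \<le> I (w n)" using R' by (simp add: power_divide)
    moreover have "(t n)\<^sup>2 > 0" using elim by simp
    ultimately show False using Iw[of n] by linarith
  qed
  then show False by simp
qed

text \<open>Condition (B2) for a constant sequence of directions; it provides the hypothesis of
\<open>superlevel_bounded\<close> when \<open>E\<close> is a singleton.\<close>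

lemma ray_lower_bound:
  assumes e: "e \<in> Xp" "norm e = 1"
  obtains R where "\<And>s. s > R \<Longrightarrow> I (s *\<^sub>R e) \<ge> 1"
proof (rule ccontr)
  assume "\<not> thesis"
  with that have "\<forall>n. \<exists>s > real n. I (s *\<^sub>R e) < 1" by (metis not_le)
  then obtain s where s: "\<And>n. s n > real n" "\<And>n. I (s n *\<^sub>R e) < 1" by metis
  have top: "filterlim s at_top sequentially"
    using s(1) by (intro filterlim_at_top_mono[OF filterlim_real_sequentially])
      (auto simp: less_imp_le)
  have "P e = e" using P_comb[OF e(1) subspace_0[OF subspace_Xt], of 1] by simp
  then have "\<exists>p\<in>Xp. p \<noteq> 0 \<and> (\<lambda>n::nat. P e) \<longlonglongrightarrow> p" using e by (intro bexI[of _ e]) auto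
  with top have "filterlim (\<lambda>n. I (s n *\<^sub>R e) / (s n)\<^sup>2) at_top sequentially"
    using B2[unfolded cond_B2_def, rule_format, of s "\<lambda>_. e"] by blast
  then have "\<forall>\<^sub>F n in sequentially. I (s n *\<^sub>R e) / (s n)\<^sup>2 \<ge> 1"
    by (simp add: filterlim_at_top)
  moreover have "\<forall>\<^sub>F n in sequentially. s n \<ge> 1" using top by (simp add: filterlim_at_top)
  ultimately have "\<forall>\<^sub>F n in sequentially. False"
  proof eventually_elim
    case (elim n)
    then have "(s n)\<^sup>2 \<le> I (s n *\<^sub>R e)" "(s n)\<^sup>2 \<ge> 1" by (auto simp: field_simps)
    then show False using s(2)[of n] by simp
  qed
  then show False by simp
qed

lemma halfspace_superlevel_bounded:
  assumes "u \<notin> Xt"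
  obtains M where "\<And>w. w \<in> halfspace Xt u \<Longrightarrow> J w \<ge> 0 \<Longrightarrow> norm w \<le> M"
proof -
  obtain R where "\<And>s. s > R \<Longrightarrow> I (s *\<^sub>R sgn (P u)) \<ge> 1"
    using ray_lower_bound[OF sgn_P(1,2)[OF assms]] by blast
  then obtain M where "\<And>e w. e \<in> {sgn (P u)} \<Longrightarrow> w \<in> halfspace Xt e \<Longrightarrow> J w \<ge> 0 \<Longrightarrow> norm w \<le> M"
    using superlevel_bounded[of "{sgn (P u)}" R] sgn_P(1,2)[OF assms] by blast
  then show thesis using that sgn_P(3)[OF assms] by blast
qed

text \<open>The direct method. The supremum \<open>S\<close> is positive by (A4), so a maximising sequence may be chosen in
the superlevel set at zero, which is bounded. Its coordinates \<open>t n\<close> converge along a subsequence, and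
its parts \<open>v n\<close> do so weakly; lower semicontinuity (A2) shows that the limit is a maximiser. It lies
off \<open>Xt\<close> because \<open>J\<close> is nonpositive there.\<close>

lemma maximum_attained:
  assumes e: "e \<in> Xp" "norm e = 1"
  obtains w where "w \<in> halfspace Xt e" "w \<notin> Xt" "\<And>y. y \<in> halfspace Xt e \<Longrightarrow> J y \<le> J w"
proof -
  have Pe: "P e = e" using P_comb[OF e(1) subspace_0[OF subspace_Xt], of 1] by simp
  have eX: "e \<notin> Xt" using e Pe Xt_iff[of e] by auto
  obtain r d where rd: "r > 0" "d > 0" "d \<le> J (r *\<^sub>R e)"
    using sphere_lower_bound e by metis
  have re: "r *\<^sub>R e \<in> halfspace Xt e"
    using halfspaceI[of r 0 Xt e] rd subspace_0[OF subspace_Xt] by simp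
  obtain M where M: "\<And>w. w \<in> halfspace Xt e \<Longrightarrow> J w \<ge> 0 \<Longrightarrow> norm w \<le> M"
    using halfspace_superlevel_bounded[OF eX] by blast
  have "J y \<le> M\<^sup>2 / 2" if "y \<in> halfspace Xt e" for y
  proof (cases "J y \<ge> 0")
    case True
    then have "norm (P y) \<le> M" using M[OF that] norm_P_le[of y] by linarith
    then have "(norm (P y))\<^sup>2 \<le> M\<^sup>2" by (intro power_mono) auto
    then show ?thesis using I_nonneg[of y] by (simp add: J_form)
  qed (use zero_le_power2[of M] in linarith)
  then have bdd: "bdd_above (J ` halfspace Xt e)" by (rule bdd_aboveI2)
  define S where "S = (SUP y\<in>halfspace Xt e. J y)"
  have S: "J y \<le> S" if "y \<in> halfspace Xt e" for y
    unfolding S_def using that bdd by (rule cSUP_upper)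
  have "S > 0" using S[OF re] rd by linarith
  \<comment> \<open>The tolerance \<open>S / (n + 2)\<close> is smaller than \<open>S\<close>, which keeps \<open>J\<close> positive along the whole sequence.\<close>
  have "\<exists>y\<in>halfspace Xt e. S - S / real (n + 2) < J y" for n
  proof -
    have "S - S / real (n + 2) < (SUP y\<in>halfspace Xt e. J y)"
      using \<open>S > 0\<close> by (simp add: S_def[symmetric])
    then show ?thesis using re bdd less_cSUP_iff by (metis (no_types, lifting) empty_iff)
  qed
  then have "\<forall>n. \<exists>t v. t \<ge> 0 \<and> v \<in> Xt \<and> S - S / real (n + 2) < J (t *\<^sub>R e + v)"
    unfolding halfspace_def by blast
  then obtain t v where tv: "\<And>n. t n \<ge> (0::real)" "\<And>n. v n \<in> Xt"
      "\<And>n. S - S / real (n + 2) < J (t n *\<^sub>R e + v n)" by metis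
  define w where "w n = t n *\<^sub>R e + v n" for n
  have wH: "w n \<in> halfspace Xt e" for n unfolding w_def using tv by (intro halfspaceI)
  have Pw: "P (w n) = t n *\<^sub>R e" for n unfolding w_def using e tv by (intro P_comb)
  have "J (w n) \<ge> 0" for n
  proof -
    have "S / real (n + 2) \<le> S" using \<open>S > 0\<close> by (simp add: field_simps)
    then show ?thesis using tv(3)[of n] by (simp add: w_def)
  qed
  then have nw: "norm (w n) \<le> M" for n using M wH by blast
  have nt: "norm (t n) \<le> M" for n
    using norm_P_le[of "w n"] nw[of n] Pw[of n] e tv(1)[of n] by simp
  have nv: "norm (v n) \<le> M + M" for n
    using norm_triangle_ineq4[of "w n" "t n *\<^sub>R e"] nw[of n] nt[of n] e by (simp add: w_def)
  have "bounded (range t)" using nt by (auto simp: bounded_iff)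
  then obtain t0 r1 where r1: "strict_mono r1" "(t \<circ> r1) \<longlonglongrightarrow> t0"
    using bounded_imp_convergent_subsequence by blast
  have "bounded (range (v \<circ> r1))" using nv by (auto simp: bounded_iff)
  then obtain v0 r2 where r2: "strict_mono r2" "weak_limit (v \<circ> r1 \<circ> r2) v0"
    using reflexive_weakly_sequentially_compact[OF reflexive] by blast
  define q where "q = r1 \<circ> r2"
  have q: "strict_mono q" unfolding q_def using r1 r2 by (intro strict_mono_o)
  have tq: "(\<lambda>n. t (q n)) \<longlonglongrightarrow> t0"
    using LIMSEQ_subseq_LIMSEQ[OF r1(2) r2(1)] by (simp add: q_def o_def)
  have vq: "weak_limit (\<lambda>n. v (q n)) v0" using r2(2) by (simp add: q_def o_def)
  have v0: "v0 \<in> Xt"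
    using weak_limit_in_closed_subspace[OF subspace_Xt closed_Xt _ vq] tv by blast
  have t0: "t0 \<ge> 0" using tv(1) by (intro LIMSEQ_le_const[OF tq]) auto
  define z where "z = t0 *\<^sub>R e + v0"
  have zH: "z \<in> halfspace Xt e" unfolding z_def using t0 v0 by (rule halfspaceI)
  have Pz: "P z = t0 *\<^sub>R e" unfolding z_def using e v0 by (intro P_comb)
  have "T_limit Xp Xt (\<lambda>n. w (q n)) z"
    unfolding T_limit_def component_Xt Pw Pz
    using vq tq by (auto simp: w_def z_def intro: tendsto_scaleR)
  then have lim: "ereal (I z) \<le> liminf (\<lambda>n. ereal (I (w (q n))))"
    using A2 by (auto simp: cond_A2_def)
  have Jlim: "(\<lambda>n. J (w n)) \<longlonglongrightarrow> S"
  proof (rule tendsto_sandwich)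
    show "(\<lambda>n. S - S / real (n + 2)) \<longlonglongrightarrow> S"
    proof -
      have "(\<lambda>n. S / real (n + 2)) \<longlonglongrightarrow> 0"
        using LIMSEQ_ignore_initial_segment[OF lim_const_over_n[of S], of 2] by simp
      then show ?thesis using tendsto_diff[OF tendsto_const[of S]] by fastforce
    qed
    show "\<forall>\<^sub>F n in sequentially. S - S / real (n + 2) \<le> J (w n)"
      using tv(3) by (auto simp: w_def less_imp_le)
    show "\<forall>\<^sub>F n in sequentially. J (w n) \<le> S" using S wH by simp
  qed simp
  have "I (w n) = (t n)\<^sup>2 / 2 - J (w n)" for n
    using J_comb[OF e tv(2)[of n], of "t n"] by (simp add: w_def)
  then have "(\<lambda>n. I (w (q n))) \<longlonglongrightarrow> t0\<^sup>2 / 2 - S"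
    using LIMSEQ_subseq_LIMSEQ[OF Jlim q] tq by (auto simp: o_def intro!: tendsto_intros)
  then have "liminf (\<lambda>n. ereal (I (w (q n)))) = ereal (t0\<^sup>2 / 2 - S)"
    by (intro lim_imp_Liminf) auto
  then have "I z \<le> t0\<^sup>2 / 2 - S" using lim by simp
  then have Jz: "S \<le> J z" using J_comb[OF e v0, of t0] by (simp add: z_def)
  have "z \<notin> Xt"
  proof
    assume "z \<in> Xt"
    then have "J z \<le> 0" using Xt_iff[of z] I_nonneg[of z] by (simp add: J_form)
    then show False using Jz \<open>S > 0\<close> by linarith
  qed
  then show thesis using that[OF zH] S Jz order_trans by blast
qed

lemma nehari_projection:
  assumes u: "u \<notin> Xt"
  obtains w where "w \<in> N" "w \<in> halfspace Xt u" "w \<notin> Xt"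
    "\<And>y. y \<in> halfspace Xt u \<Longrightarrow> J y \<le> J w"
proof -
  obtain w where w: "w \<in> halfspace Xt u" "w \<notin> Xt" "\<And>y. y \<in> halfspace Xt u \<Longrightarrow> J y \<le> J w"
    using maximum_attained[OF sgn_P(1,2)[OF u]] sgn_P(3)[OF u] by metis
  moreover have "w \<in> N"
    using w halfspace_eq[OF subspace_Xt w(1,2)] by (intro maximiser_in_nehari) auto
  ultimately show thesis using that by blast
qed

text \<open>The ground level as a real number; the next lemma shows that nothing is lost by the conversion. Its
lower bound comes from comparing a point of \<open>N\<close> with the point of norm \<open>r\<close> in \<open>Xp\<close> on the same
half-space.\<close>

definition level :: real where "level = real_of_ereal (ground_level Xt J)"

lemma ground_level_eq: "ground_level Xt J = ereal level" and level_pos: "level > 0"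
proof -
  obtain r d where rd: "r > 0" "d > 0" "\<And>e. e \<in> Xp \<Longrightarrow> norm e = 1 \<Longrightarrow> d \<le> J (r *\<^sub>R e)"
    using sphere_lower_bound by metis
  have "d \<le> J u" if u: "u \<in> N" for u
  proof -
    have uX: "u \<notin> Xt" using u by (simp add: nehari_pankov_set_def)
    have "r *\<^sub>R sgn (P u) \<in> halfspace Xt u"
      using halfspaceI[of r 0 Xt "sgn (P u)"] rd(1) subspace_0[OF subspace_Xt] sgn_P(3)[OF uX]
      by simp
    then show ?thesis using nehari_maximises[OF u] rd(3)[OF sgn_P(1,2)[OF uX]] by fastforce
  qed
  then have ge: "ereal d \<le> ground_level Xt J"
    unfolding ground_level_def by (intro INF_greatest) auto
  obtain p where p: "p \<in> Xp" "p \<noteq> 0" using nontrivial subspace_0[OF subspace_Xp] by auto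
  have "p \<notin> Xt"
    using P_comb[OF p(1) subspace_0[OF subspace_Xt], of 1] p(2) Xt_iff[of p] by simp
  then obtain w where "w \<in> N" using nehari_projection by blast
  then have le: "ground_level Xt J \<le> ereal (J w)"
    unfolding ground_level_def by (rule INF_lower)
  show eq: "ground_level Xt J = ereal level"
    using ge le unfolding level_def by (cases "ground_level Xt J") auto
  show "level > 0" using ge rd(2) unfolding eq by simp
qed

lemma level_le: "u \<in> N \<Longrightarrow> level \<le> J u"
  using INF_lower[of u N "\<lambda>u. ereal (J u)"] ground_level_eq by (simp add: ground_level_def)

lemma level_approx:
  assumes "\<epsilon> > 0"
  obtains u where "u \<in> N" "u \<notin> Xt" "J u < level + \<epsilon>"
proof -
  have "(INF u\<in>N. ereal (J u)) < ereal (level + \<epsilon>)"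
    using ground_level_eq assms by (simp add: ground_level_def)
  then obtain u where "u \<in> N" "J u < level + \<epsilon>" by (auto simp: INF_less_iff)
  then show thesis using that unfolding nehari_pankov_set_def by blast
qed

end

section \<open>Dependence of the ground level on the parameter\<close>

locale nehari_family = norm_splitting Xp Xt
  for Xp Xt :: "'a::real_normed_vector set" +
  fixes \<Lambda> :: "real set" and I J :: "real \<Rightarrow> 'a \<Rightarrow> real" and L :: real
  assumes functional: "\<mu> \<in> \<Lambda> \<Longrightarrow> nehari_functional Xp Xt (I \<mu>) (J \<mu>)"
    and L_pos: "L > 0"
    and J_diff: "\<mu> \<in> \<Lambda> \<Longrightarrow> \<nu> \<in> \<Lambda> \<Longrightarrow> \<mu> > \<nu> \<Longrightarrow> u \<notin> Xt \<Longrightarrow>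
        0 < J \<mu> u - J \<nu> u \<and> J \<mu> u - J \<nu> u \<le> L * (\<mu> - \<nu>) * (norm u)\<^sup>2"
begin

abbreviation c :: "real \<Rightarrow> real" where "c \<mu> \<equiv> nehari_functional.level Xt (J \<mu>)"
abbreviation N :: "real \<Rightarrow> 'a set" where "N \<mu> \<equiv> nehari_pankov_set Xt (J \<mu>)"

lemma J_increment_le:
  assumes "\<mu> \<in> \<Lambda>" "\<nu> \<in> \<Lambda>" "\<nu> < \<mu>" "u \<notin> Xt" "norm u \<le> M"
  shows "J \<mu> u \<le> J \<nu> u + L * (\<mu> - \<nu>) * M\<^sup>2"
proof -
  have "J \<mu> u - J \<nu> u \<le> L * (\<mu> - \<nu>) * (norm u)\<^sup>2" using J_diff assms(1-4) by blast
  also have "\<dots> \<le> L * (\<mu> - \<nu>) * M\<^sup>2"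
    using assms L_pos by (intro mult_left_mono power_mono) auto
  finally show ?thesis by simp
qed

text \<open>A point \<open>u\<close> of \<open>N \<mu>\<close> is compared with the maximiser \<open>w\<close> of \<open>J \<nu>\<close> on its half-space:
\<open>c \<nu> \<le> J \<nu> w < J \<mu> w \<le> J \<mu> u\<close>. Taking the infimum over \<open>u\<close> gives monotonicity, and choosing \<open>u\<close>
to attain the infimum gives strictness.\<close>

lemma level_less_on_nehari:
  assumes \<mu>: "\<mu> \<in> \<Lambda>" and \<nu>: "\<nu> \<in> \<Lambda>" and less: "\<nu> < \<mu>" and u: "u \<in> N \<mu>"
  shows "c \<nu> < J \<mu> u"
proof -
  interpret \<mu>: nehari_functional Xp Xt "I \<mu>" "J \<mu>" by (rule functional[OF \<mu>])
  interpret \<nu>: nehari_functional Xp Xt "I \<nu>" "J \<nu>" by (rule functional[OF \<nu>])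
  have "u \<notin> Xt" using u by (simp add: nehari_pankov_set_def)
  then obtain w where w: "w \<in> N \<nu>" "w \<in> halfspace Xt u" "w \<notin> Xt"
    using \<nu>.nehari_projection by metis
  have "c \<nu> \<le> J \<nu> w" using w(1) by (rule \<nu>.level_le)
  also have "\<dots> < J \<mu> w" using J_diff[OF \<mu> \<nu> less w(3)] by simp
  also have "\<dots> \<le> J \<mu> u" using u w(2) by (rule \<mu>.nehari_maximises)
  finally show ?thesis .
qed

lemma level_mono:
  assumes \<mu>: "\<mu> \<in> \<Lambda>" and \<nu>: "\<nu> \<in> \<Lambda>" and less: "\<nu> < \<mu>"
  shows "c \<nu> \<le> c \<mu>"
proof (rule field_le_epsilon)
  fix \<epsilon> :: real assume "\<epsilon> > 0"
  then obtain u where "u \<in> N \<mu>" "J \<mu> u < c \<mu> + \<epsilon>"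
    using nehari_functional.level_approx[OF functional[OF \<mu>]] by metis
  then show "c \<nu> \<le> c \<mu> + \<epsilon>" using level_less_on_nehari[OF \<mu> \<nu> less] by fastforce
qed

text \<open>The reverse comparison: here \<open>w\<close> maximises \<open>J \<mu>\<close> for the larger parameter, so passing from \<open>J \<mu> w\<close>
to \<open>J \<nu> w\<close> costs the Lipschitz term, which is controlled once \<open>w\<close> is bounded. Both one-sided
continuity statements reduce to finding the bound \<open>M\<close>.\<close>

lemma level_increment_le:
  assumes \<mu>: "\<mu> \<in> \<Lambda>" and \<nu>: "\<nu> \<in> \<Lambda>" and less: "\<nu> < \<mu>" and u: "u \<in> N \<nu>"
    and M: "\<And>w. w \<in> halfspace Xt u \<Longrightarrow> w \<notin> Xt \<Longrightarrow> J \<mu> w \<ge> 0 \<Longrightarrow> norm w \<le> M"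
  shows "c \<mu> \<le> J \<nu> u + L * (\<mu> - \<nu>) * M\<^sup>2"
proof -
  interpret \<mu>: nehari_functional Xp Xt "I \<mu>" "J \<mu>" by (rule functional[OF \<mu>])
  interpret \<nu>: nehari_functional Xp Xt "I \<nu>" "J \<nu>" by (rule functional[OF \<nu>])
  have "u \<notin> Xt" using u by (simp add: nehari_pankov_set_def)
  then obtain w where w: "w \<in> N \<mu>" "w \<in> halfspace Xt u" "w \<notin> Xt"
    using \<mu>.nehari_projection by metis
  have c: "c \<mu> \<le> J \<mu> w" using w(1) by (rule \<mu>.level_le)
  then have "norm w \<le> M" using \<mu>.level_pos w(2,3) by (intro M) auto
  then have "J \<mu> w \<le> J \<nu> w + L * (\<mu> - \<nu>) * M\<^sup>2" by (rule J_increment_le[OF \<mu> \<nu> less w(3)])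
  also have "J \<nu> w \<le> J \<nu> u" using u w(2) by (rule \<nu>.nehari_maximises)
  finally show ?thesis using c by simp
qed

lemma small_increment:
  assumes "\<epsilon> > 0" "0 \<le> h" "h < \<epsilon> / (L * M\<^sup>2 + 1)"
  shows "L * h * M\<^sup>2 < \<epsilon>"
proof -
  have pos: "L * M\<^sup>2 + 1 > 0" using L_pos by (simp add: add_nonneg_pos)
  have "h * (L * M\<^sup>2 + 1) < \<epsilon>" using assms(3) pos by (simp add: pos_less_divide_eq)
  then show ?thesis using assms(2) by (simp add: algebra_simps)
qed

text \<open>Here \<open>u\<close> is a fixed almost-minimiser for \<open>\<mu>\<close>, so only one half-space matters. A single parameter \<open>\<kappa>\<close>
above \<open>\<mu>\<close> bounds all maximisers for \<open>\<nu>\<close> between \<open>\<mu>\<close> and \<open>\<kappa>\<close>, since \<open>J \<nu> w \<ge> 0\<close> implies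
\<open>J \<kappa> w \<ge> 0\<close>.\<close>

lemma level_right_continuous:
  assumes \<mu>: "\<mu> \<in> \<Lambda>" and \<epsilon>: "\<epsilon> > 0"
  obtains \<delta> where "\<delta> > 0" "\<And>\<nu>. \<nu> \<in> \<Lambda> \<Longrightarrow> \<mu> < \<nu> \<Longrightarrow> \<nu> < \<mu> + \<delta> \<Longrightarrow> c \<nu> < c \<mu> + \<epsilon>"
proof (cases "\<exists>\<kappa>\<in>\<Lambda>. \<mu> < \<kappa>")
  case False
  then show thesis using that[of 1] by auto
next
  case True
  then obtain \<kappa> where \<kappa>: "\<kappa> \<in> \<Lambda>" "\<mu> < \<kappa>" by blast
  obtain u where u: "u \<in> N \<mu>" "u \<notin> Xt" "J \<mu> u < c \<mu> + \<epsilon> / 2"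
    using nehari_functional.level_approx[OF functional[OF \<mu>]] \<epsilon> by (metis half_gt_zero)
  obtain M where M: "\<And>w. w \<in> halfspace Xt u \<Longrightarrow> J \<kappa> w \<ge> 0 \<Longrightarrow> norm w \<le> M"
    using nehari_functional.halfspace_superlevel_bounded[OF functional[OF \<kappa>(1)] u(2)] by blast
  define \<delta> where "\<delta> = min (\<kappa> - \<mu>) (\<epsilon> / 2 / (L * M\<^sup>2 + 1))"
  have "\<delta> > 0" using \<kappa> \<epsilon> L_pos by (simp add: \<delta>_def add_nonneg_pos)
  moreover have "c \<nu> < c \<mu> + \<epsilon>" if \<nu>: "\<nu> \<in> \<Lambda>" "\<mu> < \<nu>" "\<nu> < \<mu> + \<delta>" for \<nu>
  proof -
    have "norm w \<le> M" if w: "w \<in> halfspace Xt u" "w \<notin> Xt" "J \<nu> w \<ge> 0" for w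
    proof -
      have "\<nu> < \<kappa>" using \<nu>(3) by (simp add: \<delta>_def)
      then have "J \<kappa> w \<ge> 0" using J_diff[OF \<kappa>(1) \<nu>(1) _ w(2)] w(3) by fastforce
      then show ?thesis using M w(1) by blast
    qed
    then have "c \<nu> \<le> J \<mu> u + L * (\<nu> - \<mu>) * M\<^sup>2"
      using level_increment_le[OF \<nu>(1) \<mu> \<nu>(2) u(1)] by blast
    moreover have "L * (\<nu> - \<mu>) * M\<^sup>2 < \<epsilon> / 2"
      using \<nu> \<epsilon> by (intro small_increment) (auto simp: \<delta>_def)
    ultimately show ?thesis using u(3) by linarith
  qed
  ultimately show thesis using that by blast
qed

text \<open>Here the almost-minimiser \<open>u\<close> for \<open>\<nu>\<close> varies with \<open>\<nu>\<close>, and the bound has to be uniform over the set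
\<open>E\<close> of all their directions. Since \<open>u\<close> maximises \<open>J \<nu>\<close> on its half-space, \<open>J \<nu> (s *\<^sub>R e) \<le> c \<mu> + 1\<close>
along the whole ray. For \<open>\<nu>\<close> close to \<open>\<mu>\<close> this yields \<open>J \<mu> (s *\<^sub>R e) \<le> c \<mu> + 1 + s\<^sup>2 / 4\<close>, while the
quadratic part of \<open>J \<mu>\<close> equals \<open>s\<^sup>2 / 2\<close>; so \<open>I \<mu> (s *\<^sub>R e)\<close> has to be large for large \<open>s\<close>, uniformly
in \<open>e\<close>.\<close>

lemma level_left_continuous:
  assumes \<mu>: "\<mu> \<in> \<Lambda>" and \<epsilon>: "\<epsilon> > 0"
  obtains \<delta> where "\<delta> > 0" "\<And>\<nu>. \<nu> \<in> \<Lambda> \<Longrightarrow> \<nu> < \<mu> \<Longrightarrow> \<mu> - \<delta> < \<nu> \<Longrightarrow> c \<mu> < c \<nu> + \<epsilon>"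
proof -
  interpret \<mu>: nehari_functional Xp Xt "I \<mu>" "J \<mu>" by (rule functional[OF \<mu>])
  define E where "E = {sgn (P u) |u. u \<notin> Xt \<and>
    (\<exists>\<nu>\<in>\<Lambda>. \<nu> < \<mu> \<and> L * (\<mu> - \<nu>) \<le> 1 / 4 \<and> u \<in> N \<nu> \<and> J \<nu> u < c \<mu> + 1)}"
  have E: "e \<in> Xp \<and> norm e = 1" if "e \<in> E" for e
    using that sgn_P by (auto simp: E_def)
  have ray: "I \<mu> (s *\<^sub>R e) \<ge> 1" if e: "e \<in> E" and s: "s > 4 * (c \<mu> + 2)" for e s
  proof -
    obtain u \<nu> where u: "e = sgn (P u)" "u \<notin> Xt" "u \<in> N \<nu>" "J \<nu> u < c \<mu> + 1"
      and \<nu>: "\<nu> \<in> \<Lambda>" "\<nu> < \<mu>" "L * (\<mu> - \<nu>) \<le> 1 / 4"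
      using e by (auto simp: E_def)
    have s1: "s > 1" using s \<mu>.level_pos by simp
    have e1: "e \<in> Xp" "norm e = 1" using E e by auto
    have Pse: "P (s *\<^sub>R e) = s *\<^sub>R e"
      using P_comb[OF e1(1) subspace_0[OF subspace_Xt], of s] by simp
    then have seX: "s *\<^sub>R e \<notin> Xt" using Xt_iff[of "s *\<^sub>R e"] s1 e1 by auto
    have "s *\<^sub>R e \<in> halfspace Xt u"
      using halfspaceI[of s 0 Xt e] s1 subspace_0[OF subspace_Xt] sgn_P(3)[OF u(2)] u(1) by simp
    then have "J \<nu> (s *\<^sub>R e) \<le> c \<mu> + 1"
      using nehari_functional.nehari_maximises[OF functional[OF \<nu>(1)] u(3)] u(4) by fastforce
    moreover have "J \<mu> (s *\<^sub>R e) \<le> J \<nu> (s *\<^sub>R e) + L * (\<mu> - \<nu>) * s\<^sup>2"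
      using J_increment_le[OF \<mu> \<nu>(1,2) seX, of s] e1 s1 by simp
    moreover have "L * (\<mu> - \<nu>) * s\<^sup>2 \<le> 1 / 4 * s\<^sup>2" using \<nu>(3) by (intro mult_right_mono) auto
    ultimately have "J \<mu> (s *\<^sub>R e) \<le> c \<mu> + 1 + s\<^sup>2 / 4" by simp
    moreover have "J \<mu> (s *\<^sub>R e) = s\<^sup>2 / 2 - I \<mu> (s *\<^sub>R e)"
      using \<mu>.J_comb[OF e1 subspace_0[OF subspace_Xt], of s] by simp
    moreover have "s \<le> s\<^sup>2" using s1 by (simp add: power2_eq_square)
    moreover have "c \<mu> + 2 < s\<^sup>2 / 4" using s \<open>s \<le> s\<^sup>2\<close> by simp
    ultimately show ?thesis by linarith
  qed
  obtain M where M: "\<And>e w. e \<in> E \<Longrightarrow> w \<in> halfspace Xt e \<Longrightarrow> J \<mu> w \<ge> 0 \<Longrightarrow> norm w \<le> M"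
    using \<mu>.superlevel_bounded[OF E ray] by blast
  define \<delta> where "\<delta> = min (1 / (4 * L)) (\<epsilon> / 2 / (L * M\<^sup>2 + 1))"
  have "\<delta> > 0" using \<epsilon> L_pos by (simp add: \<delta>_def add_nonneg_pos)
  moreover have "c \<mu> < c \<nu> + \<epsilon>" if \<nu>: "\<nu> \<in> \<Lambda>" "\<nu> < \<mu>" "\<mu> - \<delta> < \<nu>" for \<nu>
  proof -
    have "min (\<epsilon> / 2) 1 > 0" using \<epsilon> by simp
    then obtain u where u: "u \<in> N \<nu>" "u \<notin> Xt" "J \<nu> u < c \<nu> + min (\<epsilon> / 2) 1"
      using nehari_functional.level_approx[OF functional[OF \<nu>(1)]] by metis
    have "\<mu> - \<nu> \<le> 1 / (4 * L)" using \<nu>(3) by (simp add: \<delta>_def)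
    then have "L * (\<mu> - \<nu>) \<le> 1 / 4" using L_pos by (simp add: field_simps)
    moreover have "J \<nu> u < c \<mu> + 1" using u(3) level_mono[OF \<mu> \<nu>(1,2)] by linarith
    ultimately have "sgn (P u) \<in> E" using u \<nu> by (auto simp: E_def)
    then have "norm w \<le> M" if "w \<in> halfspace Xt u" "w \<notin> Xt" "J \<mu> w \<ge> 0" for w
      using M that(1,3) sgn_P(3)[OF u(2)] by blast
    then have "c \<mu> \<le> J \<nu> u + L * (\<mu> - \<nu>) * M\<^sup>2"
      by (rule level_increment_le[OF \<mu> \<nu>(1,2) u(1)])
    moreover have "L * (\<mu> - \<nu>) * M\<^sup>2 < \<epsilon> / 2"
      using \<nu> \<epsilon> by (intro small_increment) (auto simp: \<delta>_def)
    ultimately show ?thesis using u(3) by linarith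
  qed
  ultimately show thesis using that by blast
qed

lemma level_continuous: "continuous_on \<Lambda> c"
  unfolding continuous_on_iff
proof (intro ballI allI impI)
  fix \<mu> \<epsilon> :: real assume \<mu>: "\<mu> \<in> \<Lambda>" and \<epsilon>: "\<epsilon> > 0"
  obtain \<delta>1 where 1: "\<delta>1 > 0" "\<And>\<nu>. \<nu> \<in> \<Lambda> \<Longrightarrow> \<mu> < \<nu> \<Longrightarrow> \<nu> < \<mu> + \<delta>1 \<Longrightarrow> c \<nu> < c \<mu> + \<epsilon>"
    using level_right_continuous[OF \<mu> \<epsilon>] by blast
  obtain \<delta>2 where 2: "\<delta>2 > 0" "\<And>\<nu>. \<nu> \<in> \<Lambda> \<Longrightarrow> \<nu> < \<mu> \<Longrightarrow> \<mu> - \<delta>2 < \<nu> \<Longrightarrow> c \<mu> < c \<nu> + \<epsilon>"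
    using level_left_continuous[OF \<mu> \<epsilon>] by blast
  have "dist (c \<nu>) (c \<mu>) < \<epsilon>" if \<nu>: "\<nu> \<in> \<Lambda>" "dist \<nu> \<mu> < min \<delta>1 \<delta>2" for \<nu>
  proof (cases \<nu> \<mu> rule: linorder_cases)
    case less
    have "\<mu> - \<delta>2 < \<nu>" using \<nu>(2) by (auto simp: dist_real_def abs_less_iff)
    then show ?thesis
      using 2(2)[OF \<nu>(1) less] level_mono[OF \<mu> \<nu>(1) less] by (simp add: dist_real_def)
  next
    case equal
    then show ?thesis using \<epsilon> by simp
  next
    case greater
    have "\<nu> < \<mu> + \<delta>1" using \<nu>(2) by (auto simp: dist_real_def abs_less_iff)
    then show ?thesis
      using 1(2)[OF \<nu>(1) greater] level_mono[OF \<nu>(1) \<mu> greater] by (simp add: dist_real_def)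
  qed
  then show "\<exists>\<delta>>0. \<forall>\<nu>\<in>\<Lambda>. dist \<nu> \<mu> < \<delta> \<longrightarrow> dist (c \<nu>) (c \<mu>) < \<epsilon>"
    using 1(1) 2(1) by (intro exI[of _ "min \<delta>1 \<delta>2"]) auto
qed

end

theorem theorem3p4:
  fixes Xp Xt :: "'a::banach set"
    and \<Lambda> :: "real set"
    and I J :: "real \<Rightarrow> 'a \<Rightarrow> real"
    and L :: real
  assumes reflexive: "reflexive_space TYPE('a)"
    and decomposition: "topological_direct_sum Xp Xt"
    and hilbert: "hilbert_subspace Xp"
    and nontrivial: "Xp \<noteq> {0}"
    and norm_split: "\<And>u. (norm u)\<^sup>2 = (norm (component Xp Xt u))\<^sup>2 + (norm (component Xt Xp u))\<^sup>2"
    and J_C1: "\<And>\<mu>. \<mu> \<in> \<Lambda> \<Longrightarrow> C1_functional (J \<mu>)"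
    and J_form: "\<And>\<mu> u. \<mu> \<in> \<Lambda> \<Longrightarrow> J \<mu> u = 1 / 2 * (norm (component Xp Xt u))\<^sup>2 - I \<mu> u"
    and A1: "\<And>\<mu>. \<mu> \<in> \<Lambda> \<Longrightarrow> cond_A1 (I \<mu>)"
    and A2: "\<And>\<mu>. \<mu> \<in> \<Lambda> \<Longrightarrow> cond_A2 Xp Xt (I \<mu>)"
    and A3: "\<And>\<mu>. \<mu> \<in> \<Lambda> \<Longrightarrow> cond_A3 Xp Xt (I \<mu>)"
    and A4: "\<And>\<mu>. \<mu> \<in> \<Lambda> \<Longrightarrow> cond_A4 Xp (J \<mu>)"
    and B1: "\<And>\<mu>. \<mu> \<in> \<Lambda> \<Longrightarrow> cond_B1 Xp Xt (I \<mu>)"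
    and B2: "\<And>\<mu>. \<mu> \<in> \<Lambda> \<Longrightarrow> cond_B2 Xp Xt (I \<mu>)"
    and B3: "\<And>\<mu>. \<mu> \<in> \<Lambda> \<Longrightarrow> cond_B3 Xt (J \<mu>) (I \<mu>)"
    and C2: "\<And>\<mu>. \<mu> \<in> \<Lambda> \<Longrightarrow> cond_C2 Xp Xt (I \<mu>)"
    and coercive: "\<And>\<mu>. \<mu> \<in> \<Lambda> \<Longrightarrow> coercive_on (nehari_pankov_set Xt (J \<mu>)) (J \<mu>)"
    and L_pos: "L > 0"
    and J_diff: "\<And>\<mu>\<^sub>1 \<mu>\<^sub>2 u. \<mu>\<^sub>1 \<in> \<Lambda> \<Longrightarrow> \<mu>\<^sub>2 \<in> \<Lambda> \<Longrightarrow> \<mu>\<^sub>1 > \<mu>\<^sub>2 \<Longrightarrow> u \<notin> Xt \<Longrightarrow>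
        0 < J \<mu>\<^sub>1 u - J \<mu>\<^sub>2 u \<and> J \<mu>\<^sub>1 u - J \<mu>\<^sub>2 u \<le> L * (\<mu>\<^sub>1 - \<mu>\<^sub>2) * (norm u)\<^sup>2"
  shows "(\<forall>\<mu>\<in>\<Lambda>. 0 < ground_level Xt (J \<mu>) \<and> ground_level Xt (J \<mu>) < \<infinity>)
    \<and> mono_on \<Lambda> (\<lambda>\<mu>. ground_level Xt (J \<mu>))
    \<and> continuous_on \<Lambda> (\<lambda>\<mu>. ground_level Xt (J \<mu>))
    \<and> ((\<forall>\<mu>\<in>\<Lambda>. ground_level_attained Xt (J \<mu>)) \<longrightarrow>
        strict_mono_on \<Lambda> (\<lambda>\<mu>. ground_level Xt (J \<mu>)))"
proof -
  interpret nehari_family Xp Xt \<Lambda> I J L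
  proof (intro nehari_family.intro nehari_family_axioms.intro norm_splitting.intro)
    fix \<mu> assume \<mu>: "\<mu> \<in> \<Lambda>"
    show "nehari_functional Xp Xt (I \<mu>) (J \<mu>)"
      using reflexive decomposition norm_split nontrivial J_C1[OF \<mu>] J_form[OF \<mu>] A1[OF \<mu>]
        A2[OF \<mu>] A4[OF \<mu>] B1[OF \<mu>] B2[OF \<mu>] B3[OF \<mu>] C2[OF \<mu>]
      by (intro nehari_functional.intro nehari_functional_axioms.intro norm_splitting.intro)
  qed (fact decomposition norm_split L_pos J_diff)+
  have eq: "ground_level Xt (J \<mu>) = ereal (c \<mu>)" "c \<mu> > 0" if "\<mu> \<in> \<Lambda>" for \<mu>
    using nehari_functional.ground_level_eq[OF functional[OF that]]
      nehari_functional.level_pos[OF functional[OF that]] by auto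
  have "mono_on \<Lambda> (\<lambda>\<mu>. ground_level Xt (J \<mu>))"
  proof (rule mono_onI)
    fix \<nu> \<mu> assume "\<nu> \<in> \<Lambda>" "\<mu> \<in> \<Lambda>" "\<nu> \<le> \<mu>"
    then show "ground_level Xt (J \<nu>) \<le> ground_level Xt (J \<mu>)"
      using level_mono[of \<mu> \<nu>] eq by (cases "\<nu> = \<mu>") auto
  qed
  moreover have "continuous_on \<Lambda> (\<lambda>\<mu>. ground_level Xt (J \<mu>))"
    using continuous_on_ereal[OF level_continuous] eq(1) by (subst continuous_on_cong) auto
  moreover have "strict_mono_on \<Lambda> (\<lambda>\<mu>. ground_level Xt (J \<mu>))"
    if att: "\<forall>\<mu>\<in>\<Lambda>. ground_level_attained Xt (J \<mu>)"
  proof (rule strict_mono_onI)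
    fix \<nu> \<mu> assume *: "\<nu> \<in> \<Lambda>" "\<mu> \<in> \<Lambda>" "\<nu> < \<mu>"
    then obtain u where u: "u \<in> N \<mu>" "ereal (J \<mu> u) = ground_level Xt (J \<mu>)"
      using att by (auto simp: ground_level_attained_def)
    then show "ground_level Xt (J \<nu>) < ground_level Xt (J \<mu>)"
      using level_less_on_nehari[OF *(2,1,3) u(1)] eq(1)[OF *(1)] by (metis less_ereal.simps(1))
  qed
  ultimately show ?thesis using eq by auto
qed

end
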